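(* Let $f:\Sigma\to M$ be a generic Chern minimal immersion from a Riemann surface $\Sigma$ into a Hermitian surface $(M,J,g)$. Then the complex points and the anticomplex points of $f$ are isolated.
   Context: A Hermitian surface $(M,J,g)$ is a complex surface (complex dimension 2, integrable complex structure $J$) with a Hermitian metric $g$. Riemann surfaces are connected. Immersions $f:(\Sigma,\mathtt{j})\to M$ are smooth conformal isometric immersions, i.e. $ds^2_\Sigma=f^*g$ is a metric compatible with the conformal class of $\mathtt{j}$. Let $\nabla$ be the Chern connection on $TM$, i.e. the unique connection with $\nabla J=0$, $\nabla g=0$ and vanishing $(1,1)$-part of its torsion. Using the Levi-Civita connection of $ds^2_\Sigma$ on $T^*\Sigma$ and the pull-back of $\nabla$ on $f^{-1}TM$, the covariant derivative $\nabla df$ of the section $df$ of $T^*\Sigma\otimes f^{-1}TM$ is defined. The immersion $f$ is Chern minimal if $\mathrm{tr}\,\nabla df=0$ (trace with respect to $ds^2_\Sigma$). A Chern minimal $f$ is generic if it is neither holomorphic nor antiholomorphic. A point $x\in\Sigma$ is complex if $df\circ\mathtt{j}=J\circ df$ at $x$, and anticomplex if $df\circ\mathtt{j}=-J\circ df$ at $x$. *)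

theory Defs
  imports "HOL-Analysis.Analysis"
begin

section \<open>Smooth maps between open subsets of Euclidean spaces\<close>

text \<open>Only used for open \<open>X\<close>: all iterated directional derivatives up to order \<open>k\<close> exist and are
  continuous on \<open>X\<close>.\<close>

primrec diff_order :: "nat \<Rightarrow> 'a::real_normed_vector set \<Rightarrow> ('a \<Rightarrow> 'b::real_normed_vector) \<Rightarrow> bool" where
  "diff_order 0 X F \<longleftrightarrow> continuous_on X F"
| "diff_order (Suc k) X F \<longleftrightarrow>
     (\<forall>p\<in>X. F differentiable (at p)) \<and> (\<forall>v. diff_order k X (\<lambda>p. frechet_derivative F (at p) v))"

definition smooth_on :: "'a::real_normed_vector set \<Rightarrow> ('a \<Rightarrow> 'b::real_normed_vector) \<Rightarrow> bool" where
  "smooth_on X F \<longleftrightarrow> (\<forall>k. diff_order k X F)"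


section \<open>Atlases\<close>

text \<open>A manifold is a topological space (the type \<open>'a\<close>) with an atlas of charts with values in a
  Euclidean space \<open>'e\<close>. A chart is an open set together with a coordinate map, the values of which
  outside that set are irrelevant. All geometric objects below are given by their components in the
  charts of the atlas, as functions of the coordinate point.\<close>

type_synonym ('a, 'e) chart = "'a set \<times> ('a \<Rightarrow> 'e)"

definition chart_dom :: "('a, 'e) chart \<Rightarrow> 'a set" where
  "chart_dom c = fst c"

definition chart_map :: "('a, 'e) chart \<Rightarrow> 'a \<Rightarrow> 'e" where
  "chart_map c = snd c"

definition chart_codom :: "('a, 'e) chart \<Rightarrow> 'e set" where
  "chart_codom c = chart_map c ` chart_dom c"

definition chart_inv :: "('a, 'e) chart \<Rightarrow> 'e \<Rightarrow> 'a" where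
  "chart_inv c = inv_into (chart_dom c) (chart_map c)"

definition is_chart :: "('a::topological_space, 'e::euclidean_space) chart \<Rightarrow> bool" where
  "is_chart c \<longleftrightarrow> open (chart_dom c) \<and> open (chart_codom c) \<and>
     homeomorphism (chart_dom c) (chart_codom c) (chart_map c) (chart_inv c)"

text \<open>The expression of a map \<open>f\<close> in the charts \<open>c\<close> and \<open>d\<close>, and the set on which it is defined.
  For \<open>f = id\<close> this is the change of coordinates from \<open>c\<close> to \<open>d\<close>.\<close>

definition local_rep :: "('a, 'e) chart \<Rightarrow> ('b, 'h) chart \<Rightarrow> ('a \<Rightarrow> 'b) \<Rightarrow> 'e \<Rightarrow> 'h" where
  "local_rep c d f = chart_map d \<circ> f \<circ> chart_inv c"

definition rep_dom :: "('a, 'e) chart \<Rightarrow> ('b, 'h) chart \<Rightarrow> ('a \<Rightarrow> 'b) \<Rightarrow> 'e set" where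
  "rep_dom c d f = {p \<in> chart_codom c. f (chart_inv c p) \<in> chart_dom d}"

abbreviation differential :: "('e::real_normed_vector \<Rightarrow> 'h::real_normed_vector) \<Rightarrow> 'e \<Rightarrow> 'e \<Rightarrow> 'h" where
  "differential F p \<equiv> frechet_derivative F (at p)"

definition smooth_atlas :: "('a::topological_space, 'e::euclidean_space) chart set \<Rightarrow> bool" where
  "smooth_atlas A \<longleftrightarrow> (\<forall>c\<in>A. is_chart c) \<and> (\<Union>c\<in>A. chart_dom c) = UNIV \<and>
     (\<forall>c\<in>A. \<forall>d\<in>A. smooth_on (rep_dom c d id) (local_rep c d id))"

text \<open>Here \<open>J\<close> is the standard complex structure of the model space. The changes of coordinates are
  holomorphic, that is, their real differentials commute with \<open>J\<close>. The (integrable) complex structure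
  of the manifold is then the endomorphism field which is \<open>J\<close> in every chart of the atlas.\<close>

definition complex_atlas :: "('e \<Rightarrow> 'e) \<Rightarrow> ('a::topological_space, 'e::euclidean_space) chart set \<Rightarrow> bool" where
  "complex_atlas J A \<longleftrightarrow> smooth_atlas A \<and>
     (\<forall>c\<in>A. \<forall>d\<in>A. \<forall>p\<in>rep_dom c d id. \<forall>v.
        differential (local_rep c d id) p (J v) = J (differential (local_rep c d id) p v))"

definition J1 :: "complex \<Rightarrow> complex" where
  "J1 v = \<i> * v"

definition J2 :: "complex^2 \<Rightarrow> complex^2" where
  "J2 v = \<i> *s v"

definition riemann_surface :: "('s::t2_space, complex) chart set \<Rightarrow> bool" where
  "riemann_surface S \<longleftrightarrow> complex_atlas J1 S \<and> connected (UNIV :: 's set)"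

definition complex_surface :: "('m::{t2_space,second_countable_topology}, complex^2) chart set \<Rightarrow> bool" where
  "complex_surface M \<longleftrightarrow> complex_atlas J2 M"


section \<open>Metrics and connections\<close>

type_synonym ('a, 'e) metric = "('a, 'e) chart \<Rightarrow> 'e \<Rightarrow> 'e \<Rightarrow> 'e \<Rightarrow> real"

definition riemannian_metric ::
  "('a::topological_space, 'e::euclidean_space) chart set \<Rightarrow> ('a, 'e) metric \<Rightarrow> bool" where
  "riemannian_metric A g \<longleftrightarrow>
     (\<forall>c\<in>A. \<forall>u v. smooth_on (chart_codom c) (\<lambda>p. g c p u v)) \<and>
     (\<forall>c\<in>A. \<forall>p\<in>chart_codom c. bilinear (g c p) \<and>
        (\<forall>u v. g c p u v = g c p v u) \<and> (\<forall>u. u \<noteq> 0 \<longrightarrow> g c p u u > 0)) \<and>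
     (\<forall>c\<in>A. \<forall>d\<in>A. \<forall>p\<in>rep_dom c d id. \<forall>u v.
        g c p u v = g d (local_rep c d id p)
                      (differential (local_rep c d id) p u) (differential (local_rep c d id) p v))"

definition hermitian_metric ::
  "('e \<Rightarrow> 'e) \<Rightarrow> ('a::topological_space, 'e::euclidean_space) chart set \<Rightarrow> ('a, 'e) metric \<Rightarrow> bool" where
  "hermitian_metric J A g \<longleftrightarrow> riemannian_metric A g \<and>
     (\<forall>c\<in>A. \<forall>p\<in>chart_codom c. \<forall>u v. g c p (J u) (J v) = g c p u v)"

definition hermitian_surface ::
  "('m::{t2_space,second_countable_topology}, complex^2) chart set \<Rightarrow> ('m, complex^2) metric \<Rightarrow> bool" where
  "hermitian_surface M g \<longleftrightarrow> complex_surface M \<and> hermitian_metric J2 M g"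

text \<open>An affine connection is given by its Christoffel symbols \<open>G c p u v\<close>, the value at \<open>p\<close> of the
  covariant derivative in direction \<open>u\<close> of the vector field that is constantly \<open>v\<close> in the chart \<open>c\<close>.\<close>

type_synonym ('a, 'e) christoffel = "('a, 'e) chart \<Rightarrow> 'e \<Rightarrow> 'e \<Rightarrow> 'e \<Rightarrow> 'e"

text \<open>Covariant derivative at \<open>p\<close> in direction \<open>u\<close> of a vector field \<open>Y\<close>, for the connection with
  Christoffel symbols \<open>G\<close> in a fixed chart.\<close>

definition cov_deriv ::
  "('e::euclidean_space \<Rightarrow> 'e \<Rightarrow> 'e \<Rightarrow> 'e) \<Rightarrow> 'e \<Rightarrow> 'e \<Rightarrow> ('e \<Rightarrow> 'e) \<Rightarrow> 'e" where
  "cov_deriv G p u Y = differential Y p u + G p u (Y p)"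

text \<open>Covariant derivative, with respect to the pull-back by \<open>F\<close> of that connection, of a vector field
  \<open>Y\<close> along \<open>F\<close>.\<close>

definition pullback_cov_deriv ::
  "('h \<Rightarrow> 'h \<Rightarrow> 'h \<Rightarrow> 'h::euclidean_space) \<Rightarrow> ('e::euclidean_space \<Rightarrow> 'h) \<Rightarrow> 'e \<Rightarrow> 'e \<Rightarrow> ('e \<Rightarrow> 'h) \<Rightarrow> 'h" where
  "pullback_cov_deriv G F p u Y = differential Y p u + G (F p) (differential F p u) (Y p)"

text \<open>The last clause is the transformation law under changes of coordinates \<open>F\<close>: \<open>dF\<close> maps the
  covariant derivative of the field constantly \<open>v\<close> in the first chart to the covariant derivative,
  computed in the second chart, of its image \<open>dF v\<close>.\<close>

definition affine_connection ::
  "('a::topological_space, 'e::euclidean_space) chart set \<Rightarrow> ('a, 'e) christoffel \<Rightarrow> bool" where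
  "affine_connection A G \<longleftrightarrow>
     (\<forall>c\<in>A. \<forall>u v. smooth_on (chart_codom c) (\<lambda>p. G c p u v)) \<and>
     (\<forall>c\<in>A. \<forall>p\<in>chart_codom c. bilinear (G c p)) \<and>
     (\<forall>c\<in>A. \<forall>d\<in>A. \<forall>p\<in>rep_dom c d id. \<forall>u v.
        differential (local_rep c d id) p (G c p u v) =
        pullback_cov_deriv (G d) (local_rep c d id) p u (\<lambda>q. differential (local_rep c d id) q v))"

definition metric_parallel ::
  "('a::topological_space, 'e::euclidean_space) chart set \<Rightarrow> ('a, 'e) metric \<Rightarrow> ('a, 'e) christoffel \<Rightarrow> bool" where
  "metric_parallel A g G \<longleftrightarrow>
     (\<forall>c\<in>A. \<forall>Y Z. smooth_on (chart_codom c) Y \<longrightarrow> smooth_on (chart_codom c) Z \<longrightarrow>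
        (\<forall>p\<in>chart_codom c. \<forall>u.
           differential (\<lambda>q. g c q (Y q) (Z q)) p u =
           g c p (cov_deriv (G c) p u Y) (Z p) + g c p (Y p) (cov_deriv (G c) p u Z)))"

definition complex_structure_parallel ::
  "('e \<Rightarrow> 'e) \<Rightarrow> ('a::topological_space, 'e::euclidean_space) chart set \<Rightarrow> ('a, 'e) christoffel \<Rightarrow> bool" where
  "complex_structure_parallel J A G \<longleftrightarrow>
     (\<forall>c\<in>A. \<forall>Y. smooth_on (chart_codom c) Y \<longrightarrow>
        (\<forall>p\<in>chart_codom c. \<forall>u. cov_deriv (G c) p u (\<lambda>q. J (Y q)) = J (cov_deriv (G c) p u Y)))"

text \<open>The Lie bracket of fields that are constant in the chart vanishes.\<close>

definition torsion :: "('e::euclidean_space \<Rightarrow> 'e \<Rightarrow> 'e \<Rightarrow> 'e) \<Rightarrow> 'e \<Rightarrow> 'e \<Rightarrow> 'e \<Rightarrow> 'e" where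
  "torsion G p u v = cov_deriv G p u (\<lambda>_. v) - cov_deriv G p v (\<lambda>_. u)"

text \<open>The \<open>(1,1)\<close>-part of a vector-valued real \<open>2\<close>-form \<open>T\<close> is
  \<open>(u, v) \<mapsto> T(u', v'') + T(u'', v')\<close>, where \<open>T\<close> is extended complex bilinearly and
  \<open>u' = (u - \<i> J u) / 2\<close>, \<open>u'' = (u + \<i> J u) / 2\<close> are the components of \<open>u\<close> of type \<open>(1,0)\<close> and
  \<open>(0,1)\<close>. Expanding gives the following.\<close>

definition part_1_1 ::
  "('e \<Rightarrow> 'e) \<Rightarrow> ('e \<Rightarrow> 'e \<Rightarrow> 'e::real_vector) \<Rightarrow> 'e \<Rightarrow> 'e \<Rightarrow> 'e" where
  "part_1_1 J T u v = (1/2) *\<^sub>R (T u v + T (J u) (J v))"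

definition levi_civita_connection ::
  "('a::topological_space, 'e::euclidean_space) chart set \<Rightarrow> ('a, 'e) metric \<Rightarrow> ('a, 'e) christoffel \<Rightarrow> bool" where
  "levi_civita_connection A g G \<longleftrightarrow> affine_connection A G \<and> metric_parallel A g G \<and>
     (\<forall>c\<in>A. \<forall>p\<in>chart_codom c. \<forall>u v. torsion (G c) p u v = 0)"

definition chern_connection ::
  "('m::{t2_space,second_countable_topology}, complex^2) chart set \<Rightarrow> ('m, complex^2) metric
    \<Rightarrow> ('m, complex^2) christoffel \<Rightarrow> bool" where
  "chern_connection M g G \<longleftrightarrow> affine_connection M G \<and>
     complex_structure_parallel J2 M G \<and> metric_parallel M g G \<and>
     (\<forall>c\<in>M. \<forall>p\<in>chart_codom c. \<forall>u v. part_1_1 J2 (torsion (G c) p) u v = 0)"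


section \<open>Chern minimal immersions\<close>

definition smooth_map ::
  "('a::topological_space, 'e::euclidean_space) chart set \<Rightarrow>
   ('b::topological_space, 'h::euclidean_space) chart set \<Rightarrow> ('a \<Rightarrow> 'b) \<Rightarrow> bool" where
  "smooth_map A B f \<longleftrightarrow> continuous_on UNIV f \<and>
     (\<forall>c\<in>A. \<forall>d\<in>B. smooth_on (rep_dom c d f) (local_rep c d f))"

definition immersion ::
  "('a::topological_space, 'e::euclidean_space) chart set \<Rightarrow>
   ('b::topological_space, 'h::euclidean_space) chart set \<Rightarrow> ('a \<Rightarrow> 'b) \<Rightarrow> bool" where
  "immersion A B f \<longleftrightarrow> smooth_map A B f \<and>
     (\<forall>c\<in>A. \<forall>d\<in>B. \<forall>p\<in>rep_dom c d f. inj (differential (local_rep c d f) p))"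

definition is_pullback_metric ::
  "('a::topological_space, 'e::euclidean_space) chart set \<Rightarrow>
   ('b::topological_space, 'h::euclidean_space) chart set \<Rightarrow> ('a \<Rightarrow> 'b) \<Rightarrow>
   ('b, 'h) metric \<Rightarrow> ('a, 'e) metric \<Rightarrow> bool" where
  "is_pullback_metric A B f g h \<longleftrightarrow>
     (\<forall>c\<in>A. \<forall>d\<in>B. \<forall>p\<in>rep_dom c d f. \<forall>u v.
        h c p u v = g d (local_rep c d f p)
                      (differential (local_rep c d f) p u) (differential (local_rep c d f) p v))"

text \<open>On a Riemann surface, a metric is compatible with the conformal class of the complex structure
  iff the complex structure is orthogonal for it, i.e. iff it is Hermitian.\<close>

definition conformal_isometric_immersion ::
  "('s::t2_space, complex) chart set \<Rightarrow> ('m::{t2_space,second_countable_topology}, complex^2) chart set \<Rightarrow>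
   ('m, complex^2) metric \<Rightarrow> ('s \<Rightarrow> 'm) \<Rightarrow> ('s, complex) metric \<Rightarrow> bool" where
  "conformal_isometric_immersion S M g f ds2 \<longleftrightarrow> immersion S M f \<and>
     is_pullback_metric S M f g ds2 \<and> hermitian_metric J1 S ds2"

text \<open>\<open>(\<nabla>df)(u, v)\<close> at \<open>p\<close>, for a map with local expression \<open>F\<close>, where \<open>D\<close> are the Christoffel symbols
  of the domain and \<open>G\<close> those of the target: the dual connection on the cotangent factor gives
  \<open>(\<nabla>\<^sub>u df)(V) = \<nabla>\<^sub>u (df V) - df (D\<^sub>u V)\<close>, which is tensorial in \<open>V\<close>, here taken constantly \<open>v\<close>.\<close>

definition nabla_df ::
  "('e::euclidean_space \<Rightarrow> 'e \<Rightarrow> 'e \<Rightarrow> 'e) \<Rightarrow> ('h::euclidean_space \<Rightarrow> 'h \<Rightarrow> 'h \<Rightarrow> 'h) \<Rightarrow>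
   ('e \<Rightarrow> 'h) \<Rightarrow> 'e \<Rightarrow> 'e \<Rightarrow> 'e \<Rightarrow> 'h" where
  "nabla_df D G F p u v =
     pullback_cov_deriv G F p u (\<lambda>q. differential F q v)
     - differential F p (cov_deriv D p u (\<lambda>_. v))"

definition orthonormal_basis :: "('e \<Rightarrow> 'e \<Rightarrow> real) \<Rightarrow> 'e::euclidean_space set \<Rightarrow> bool" where
  "orthonormal_basis h E \<longleftrightarrow> finite E \<and> card E = DIM('e) \<and>
     (\<forall>u\<in>E. \<forall>v\<in>E. h u v = (if u = v then 1 else 0))"

definition metric_trace ::
  "('e \<Rightarrow> 'e \<Rightarrow> real) \<Rightarrow> ('e::euclidean_space \<Rightarrow> 'e \<Rightarrow> 'h::real_vector) \<Rightarrow> 'h" where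
  "metric_trace h B = (\<Sum>e\<in>(SOME E. orthonormal_basis h E). B e e)"

definition chern_minimal ::
  "('s::t2_space, complex) chart set \<Rightarrow> ('m::{t2_space,second_countable_topology}, complex^2) chart set \<Rightarrow>
   ('m, complex^2) christoffel \<Rightarrow> ('s, complex) metric \<Rightarrow> ('s, complex) christoffel \<Rightarrow> ('s \<Rightarrow> 'm) \<Rightarrow> bool" where
  "chern_minimal S M nabla ds2 D f \<longleftrightarrow>
     (\<forall>c\<in>S. \<forall>d\<in>M. \<forall>p\<in>rep_dom c d f.
        metric_trace (ds2 c p) (nabla_df (D c) (nabla d) (local_rep c d f) p) = 0)"

definition complex_point ::
  "('s::t2_space, complex) chart set \<Rightarrow> ('m::{t2_space,second_countable_topology}, complex^2) chart set \<Rightarrow>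
   ('s \<Rightarrow> 'm) \<Rightarrow> 's \<Rightarrow> bool" where
  "complex_point S M f x \<longleftrightarrow>
     (\<forall>c\<in>S. \<forall>d\<in>M. x \<in> chart_dom c \<longrightarrow> f x \<in> chart_dom d \<longrightarrow>
        differential (local_rep c d f) (chart_map c x) \<circ> J1 =
        J2 \<circ> differential (local_rep c d f) (chart_map c x))"

definition anticomplex_point ::
  "('s::t2_space, complex) chart set \<Rightarrow> ('m::{t2_space,second_countable_topology}, complex^2) chart set \<Rightarrow>
   ('s \<Rightarrow> 'm) \<Rightarrow> 's \<Rightarrow> bool" where
  "anticomplex_point S M f x \<longleftrightarrow>
     (\<forall>c\<in>S. \<forall>d\<in>M. x \<in> chart_dom c \<longrightarrow> f x \<in> chart_dom d \<longrightarrow>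
        differential (local_rep c d f) (chart_map c x) \<circ> J1 =
        (\<lambda>v. - J2 (differential (local_rep c d f) (chart_map c x) v)))"

definition holomorphic_map ::
  "('s::t2_space, complex) chart set \<Rightarrow> ('m::{t2_space,second_countable_topology}, complex^2) chart set \<Rightarrow>
   ('s \<Rightarrow> 'm) \<Rightarrow> bool" where
  "holomorphic_map S M f \<longleftrightarrow> smooth_map S M f \<and> (\<forall>x. complex_point S M f x)"

definition antiholomorphic_map ::
  "('s::t2_space, complex) chart set \<Rightarrow> ('m::{t2_space,second_countable_topology}, complex^2) chart set \<Rightarrow>
   ('s \<Rightarrow> 'm) \<Rightarrow> bool" where
  "antiholomorphic_map S M f \<longleftrightarrow> smooth_map S M f \<and> (\<forall>x. anticomplex_point S M f x)"

definition generic ::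
  "('s::t2_space, complex) chart set \<Rightarrow> ('m::{t2_space,second_countable_topology}, complex^2) chart set \<Rightarrow>
   ('s \<Rightarrow> 'm) \<Rightarrow> bool" where
  "generic S M f \<longleftrightarrow> \<not> holomorphic_map S M f \<and> \<not> antiholomorphic_map S M f"

end

theory Submission
  imports Defs
begin

text \<open>In holomorphic charts the map is a function \<open>F\<close> from a planar domain to \<open>\<complex>\<^sup>2\<close>. Write
  \<open>\<partial>F = F\<^sub>x - J F\<^sub>y\<close> and \<open>\<partial>'F = F\<^sub>x + J F\<^sub>y\<close>; the complex points are the zeros of \<open>\<partial>'F\<close>, and
  replacing \<open>J\<close> by \<open>- J\<close> throughout gives the anticomplex points.

  Because \<open>J\<close> is parallel and the torsion has no \<open>(1,1)\<close>-part, the Christoffel symbols \<open>\<Gamma>\<close> of the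
  Chern connection are complex bilinear (\<open>chern_connection_complex_bilinear\<close>). Those of the
  Levi-Civita connection of a conformal plane metric have trace zero (\<open>levi_civita_conformal\<close>). Hence
  Chern minimality reads \<open>\<Delta>F + \<Gamma>(F\<^sub>x, F\<^sub>x) + \<Gamma>(F\<^sub>y, F\<^sub>y) = 0\<close>. As \<open>\<Delta> = \<partial>\<partial>'\<close> and \<open>\<Gamma>\<close> is complex
  bilinear, this is \<open>\<partial>(\<partial>'F) = - (\<Gamma>(\<partial>F, \<partial>'F) + \<Gamma>(\<partial>'F, \<partial>F)) / 2\<close>: for given \<open>F\<close> it is a homogeneous
  complex linear first order equation for \<open>\<partial>'F\<close>, a Cauchy--Riemann system for the structure \<open>- J\<close>.

  A solution \<open>W\<close> of a Cauchy--Riemann system \<open>\<partial>'W = E W\<close> behaves near a zero like a holomorphic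
  function. If it vanishes to finite order \<open>k\<close>, then, as the derivatives involving \<open>\<partial>'\<close> are controlled
  by lower ones, its leading term is \<open>c (z - p)\<^sup>k\<close> with \<open>c \<noteq> 0\<close>, and the zero is isolated
  (\<open>isolated_zero_of_finite_order\<close>). If it vanishes to infinite order, it vanishes nearby
  (\<open>strong_unique_continuation\<close>). The latter is a maximum principle: complex linearity of
  \<open>E\<close> makes \<open>\<Delta> ln |W|\<^sup>2\<close> bounded below off the zeros, so for a large constant \<open>N\<close> and every \<open>k\<close> the function
  \<open>ln |W|\<^sup>2 + N |z - p|\<^sup>2 - k ln |z - p|\<^sup>2\<close> is strictly subharmonic there, and it tends to \<open>- \<infinity>\<close> at \<open>p\<close>.
  By the maximum principle it is bounded by its values on a circle around \<open>p\<close>; letting \<open>k\<close> grow forces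
  \<open>W = 0\<close> inside.

  So every point of the surface has a neighbourhood that consists of complex points or contains no
  other complex point. By connectedness, either all points are complex, which genericity excludes,
  or the complex points are isolated (\<open>discrete_or_everything\<close>).\<close>

section \<open>Calculus of smooth maps\<close>

abbreviation dir_deriv :: "'a \<Rightarrow> ('a::real_normed_vector \<Rightarrow> 'b::real_normed_vector) \<Rightarrow> 'a \<Rightarrow> 'b" where
  "dir_deriv v F \<equiv> \<lambda>p. differential F p v"

lemma has_derivative_differential:
  "F differentiable (at p) \<Longrightarrow> (F has_derivative differential F p) (at p)"
  using frechet_derivative_works by blast

lemma differential_eqI:
  "(F has_derivative F') (at p) \<Longrightarrow> differential F p = F'"
  using frechet_derivative_at by metis

text \<open>Also where \<open>F\<close> is not differentiable: the two functions have the same derivatives at \<open>p\<close>, hence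
  the same choice of one, even if there is none.\<close>

lemma differential_cong:
  assumes "open X" "p \<in> X" "\<And>q. q \<in> X \<Longrightarrow> F q = G q"
  shows "differential F p = differential G p"
proof (cases "F differentiable (at p)")
  case True
  then show ?thesis
    using frechet_derivative_transform_within_open[OF True assms] by blast
next
  case False
  have "\<not> G differentiable (at p)"
  proof
    assume "G differentiable (at p)"
    then obtain G' where "(G has_derivative G') (at p)" by (auto simp: differentiable_def)
    then have "(F has_derivative G') (at p)"
      by (rule has_derivative_transform_within_open[OF _ assms(1,2)]) (use assms(3) in auto)
    then show False using False by (auto simp: differentiable_def)
  qed
  with False have "(F has_derivative D) (at p) \<longleftrightarrow> (G has_derivative D) (at p)" for D
    by (auto simp: differentiable_def)
  then show ?thesis
    by (simp add: frechet_derivative_def)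
qed

lemma diff_order_cong:
  assumes "open X" "\<And>p. p \<in> X \<Longrightarrow> F p = G p" "diff_order k X F"
  shows "diff_order k X G"
  using assms(2,3)
proof (induction k arbitrary: F G)
  case 0
  then show ?case by (simp cong: continuous_on_cong)
next
  case (Suc k)
  have "G differentiable (at p)" if "p \<in> X" for p
  proof -
    have "(F has_derivative differential F p) (at p)"
      using Suc.prems(2) that by (auto intro: has_derivative_differential)
    then have "(G has_derivative differential F p) (at p)"
      by (rule has_derivative_transform_within_open[OF _ assms(1) that]) (use Suc.prems in auto)
    then show ?thesis by (auto simp: differentiable_def)
  qed
  moreover have "diff_order k X (dir_deriv v G)" for v
  proof (rule Suc.IH)
    show "diff_order k X (dir_deriv v F)" using Suc.prems by simp
    show "dir_deriv v F p = dir_deriv v G p" if "p \<in> X" for p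
      using differential_cong[OF assms(1) that Suc.prems(1)] by simp
  qed
  ultimately show ?case by simp
qed

lemma diff_order_SucD: "diff_order (Suc k) X F \<Longrightarrow> diff_order k X F"
proof (induction k arbitrary: F)
  case 0
  then show ?case
    by (auto intro!: continuous_at_imp_continuous_on dest: differentiable_imp_continuous_within)
qed auto

lemma diff_order_const: "diff_order k X (\<lambda>_. c)"
  by (induction k arbitrary: c) auto

lemma diff_order_bounded_linear:
  assumes "open X" "bounded_linear L" "diff_order k X F"
  shows "diff_order k X (\<lambda>p. L (F p))"
  using assms(3)
proof (induction k arbitrary: F)
  case 0
  then show ?case
    using bounded_linear.continuous_on[OF assms(2)] by auto
next
  case (Suc k)
  have d: "((\<lambda>p. L (F p)) has_derivative (\<lambda>v. L (differential F p v))) (at p)" if "p \<in> X" for p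
    by (rule bounded_linear.has_derivative[OF assms(2) has_derivative_differential])
       (use Suc.prems that in simp)
  have "diff_order k X (dir_deriv v (\<lambda>p. L (F p)))" for v
    by (rule diff_order_cong[OF assms(1) _ Suc.IH[of "dir_deriv v F"]])
       (use Suc.prems differential_eqI[OF d] in auto)
  with d show ?case by (auto simp: differentiable_def)
qed

lemma diff_order_add:
  assumes "open X" "diff_order k X F" "diff_order k X G"
  shows "diff_order k X (\<lambda>p. F p + G p)"
  using assms(2,3)
proof (induction k arbitrary: F G)
  case 0
  then show ?case by (auto intro: continuous_on_add)
next
  case (Suc k)
  have d: "((\<lambda>p. F p + G p) has_derivative (\<lambda>v. differential F p v + differential G p v)) (at p)"
    if "p \<in> X" for p
    by (intro has_derivative_add has_derivative_differential) (use Suc.prems that in auto)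
  have "diff_order k X (dir_deriv v (\<lambda>p. F p + G p))" for v
    by (rule diff_order_cong[OF assms(1) _ Suc.IH[of "dir_deriv v F" "dir_deriv v G"]])
       (use Suc.prems differential_eqI[OF d] in auto)
  with d show ?case by (auto simp: differentiable_def)
qed

lemma diff_order_sum:
  assumes "open X" "finite I" "\<And>i. i \<in> I \<Longrightarrow> diff_order k X (F i)"
  shows "diff_order k X (\<lambda>p. \<Sum>i\<in>I. F i p)"
  using assms(2,3)
  by (induction I rule: finite_induct) (auto intro: diff_order_const diff_order_add[OF assms(1)])

lemma diff_order_bilinear:
  assumes "open X" "bounded_bilinear B" "diff_order k X F" "diff_order k X G"
  shows "diff_order k X (\<lambda>p. B (F p) (G p))"
  using assms(3,4)
proof (induction k arbitrary: F G)
  case 0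
  then show ?case
    using bounded_bilinear.continuous_on[OF assms(2)] by auto
next
  case (Suc k)
  have d: "((\<lambda>p. B (F p) (G p)) has_derivative
      (\<lambda>v. B (F p) (differential G p v) + B (differential F p v) (G p))) (at p)"
    if "p \<in> X" for p
    by (rule bounded_bilinear.FDERIV[OF assms(2)])
       (use Suc.prems that in \<open>auto intro: has_derivative_differential\<close>)
  have "diff_order k X (dir_deriv v (\<lambda>p. B (F p) (G p)))" for v
  proof (rule diff_order_cong[OF assms(1)])
    show "diff_order k X (\<lambda>p. B (F p) (dir_deriv v G p) + B (dir_deriv v F p) (G p))"
      using Suc.prems diff_order_SucD[OF Suc.prems(1)] diff_order_SucD[OF Suc.prems(2)]
      by (intro diff_order_add assms(1) Suc.IH) auto
  qed (use differential_eqI[OF d] in auto)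
  with d show ?case by (auto simp: differentiable_def)
qed

lemma differential_in_basis:
  fixes F :: "'a::euclidean_space \<Rightarrow> 'b::real_normed_vector"
  assumes "F differentiable (at p)"
  shows "differential F p v = (\<Sum>e\<in>Basis. (v \<bullet> e) *\<^sub>R differential F p e)"
proof -
  have l: "linear (differential F p)" by (rule linear_frechet_derivative[OF assms])
  have "differential F p v = differential F p (\<Sum>e\<in>Basis. (v \<bullet> e) *\<^sub>R e)"
    by (simp add: euclidean_representation)
  then show ?thesis by (simp add: linear_sum[OF l] linear_scale[OF l])
qed

text \<open>The derivative of the composition is a sum of products of derivatives of \<open>F\<close> with compositions of
  one derivative of \<open>H\<close>; the smoothness of \<open>F\<close> is kept whole so that the induction runs over \<open>H\<close>.\<close>

lemma diff_order_compose:
  fixes H :: "'b::euclidean_space \<Rightarrow> 'c::real_normed_vector"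
  assumes "open X" "open Y" "F ` X \<subseteq> Y" "smooth_on X F" "diff_order k Y H"
  shows "diff_order k X (\<lambda>p. H (F p))"
  using assms(5)
proof (induction k arbitrary: H)
  case 0
  have "continuous_on X F" using assms(4)[unfolded smooth_on_def, rule_format, of 0] by simp
  with 0 show ?case using continuous_on_compose2[of Y H X F] assms(3) by simp
next
  case (Suc k)
  have dF: "F differentiable (at p)" if "p \<in> X" for p
    using assms(4)[unfolded smooth_on_def, rule_format, of 1] that by simp
  have dH: "H differentiable (at (F p))" if "p \<in> X" for p
    using Suc.prems that assms(3) by auto
  have d: "((\<lambda>p. H (F p)) has_derivative (\<lambda>v. differential H (F p) (differential F p v))) (at p)"
    if "p \<in> X" for p
    using diff_chain_at[OF has_derivative_differential[OF dF[OF that]] has_derivative_differential[OF dH[OF that]]]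
    by (simp add: o_def)
  have "diff_order k X (dir_deriv v (\<lambda>p. H (F p)))" for v
  proof (rule diff_order_cong[OF assms(1)])
    have "diff_order k X (dir_deriv v F)"
      using assms(4)[unfolded smooth_on_def, rule_format, of "Suc k"] by simp
    moreover have "diff_order k X (\<lambda>p. dir_deriv e H (F p))" for e
      by (rule Suc.IH) (use Suc.prems in simp)
    ultimately show "diff_order k X (\<lambda>p. \<Sum>e\<in>Basis. (dir_deriv v F p \<bullet> e) *\<^sub>R dir_deriv e H (F p))"
      by (intro diff_order_sum assms(1) finite_Basis
          diff_order_bilinear[OF assms(1) bounded_bilinear_scaleR]
          diff_order_bounded_linear[OF assms(1) bounded_linear_inner_left])
    show "(\<Sum>e\<in>Basis. (dir_deriv v F p \<bullet> e) *\<^sub>R dir_deriv e H (F p)) = dir_deriv v (\<lambda>p. H (F p)) p"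
      if "p \<in> X" for p
      using differential_eqI[OF d[OF that]] differential_in_basis[OF dH[OF that], of "dir_deriv v F p"]
      by simp
  qed
  with d show ?case by (auto simp: differentiable_def)
qed

lemma smooth_onD_differentiable: "smooth_on X F \<Longrightarrow> p \<in> X \<Longrightarrow> F differentiable (at p)"
  unfolding smooth_on_def by (drule spec[of _ "Suc 0"]) simp

lemma smooth_on_has_derivative:
  "smooth_on X F \<Longrightarrow> p \<in> X \<Longrightarrow> (F has_derivative differential F p) (at p)"
  by (rule has_derivative_differential[OF smooth_onD_differentiable])

lemma smooth_on_imp_continuous_on: "smooth_on X F \<Longrightarrow> continuous_on X F"
  unfolding smooth_on_def by (drule spec[of _ 0]) simp

lemma smooth_on_dir_deriv: "smooth_on X F \<Longrightarrow> smooth_on X (dir_deriv v F)"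
  unfolding smooth_on_def
proof
  fix k assume "\<forall>k. diff_order k X F"
  then have "diff_order (Suc k) X F" by blast
  then show "diff_order k X (dir_deriv v F)" by simp
qed

lemma smooth_on_cong:
  "open X \<Longrightarrow> (\<And>p. p \<in> X \<Longrightarrow> F p = G p) \<Longrightarrow> smooth_on X F \<Longrightarrow> smooth_on X G"
  unfolding smooth_on_def using diff_order_cong by blast

lemma smooth_on_const: "smooth_on X (\<lambda>_. c)"
  by (simp add: smooth_on_def diff_order_const)

lemma smooth_on_bounded_linear:
  "open X \<Longrightarrow> bounded_linear L \<Longrightarrow> smooth_on X F \<Longrightarrow> smooth_on X (\<lambda>p. L (F p))"
  by (simp add: smooth_on_def diff_order_bounded_linear)

lemma smooth_on_add:
  "open X \<Longrightarrow> smooth_on X F \<Longrightarrow> smooth_on X G \<Longrightarrow> smooth_on X (\<lambda>p. F p + G p)"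
  by (simp add: smooth_on_def diff_order_add)

lemma smooth_on_sum:
  "open X \<Longrightarrow> finite I \<Longrightarrow> (\<And>i. i \<in> I \<Longrightarrow> smooth_on X (F i)) \<Longrightarrow> smooth_on X (\<lambda>p. \<Sum>i\<in>I. F i p)"
  by (simp add: smooth_on_def diff_order_sum)

lemma smooth_on_bilinear:
  "open X \<Longrightarrow> bounded_bilinear B \<Longrightarrow> smooth_on X F \<Longrightarrow> smooth_on X G \<Longrightarrow> smooth_on X (\<lambda>p. B (F p) (G p))"
  by (simp add: smooth_on_def diff_order_bilinear)

lemma smooth_on_compose:
  fixes H :: "'b::euclidean_space \<Rightarrow> 'c::real_normed_vector"
  shows "open X \<Longrightarrow> open Y \<Longrightarrow> F ` X \<subseteq> Y \<Longrightarrow> smooth_on X F \<Longrightarrow> smooth_on Y H \<Longrightarrow> smooth_on X (\<lambda>p. H (F p))"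
  by (subst smooth_on_def) (auto intro: diff_order_compose simp: smooth_on_def[of Y H])

lemma smooth_on_along_line:
  assumes "smooth_on X F" "p + t *\<^sub>R v \<in> X"
  shows "((\<lambda>t. F (p + t *\<^sub>R v)) has_vector_derivative dir_deriv v F (p + t *\<^sub>R v)) (at t)"
proof -
  let ?D = "differential F (p + t *\<^sub>R v)"
  have "((\<lambda>t. p + t *\<^sub>R v) has_derivative (\<lambda>h. h *\<^sub>R v)) (at t)"
    by (auto intro!: derivative_eq_intros)
  from diff_chain_at[OF this smooth_on_has_derivative[OF assms]]
  have "((\<lambda>t. F (p + t *\<^sub>R v)) has_derivative (\<lambda>h. ?D (h *\<^sub>R v))) (at t)"
    by (simp add: o_def)
  moreover have "?D (h *\<^sub>R v) = h *\<^sub>R ?D v" for h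
    using linear_scale[OF linear_frechet_derivative[OF smooth_onD_differentiable[OF assms]]] .
  ultimately show ?thesis by (simp add: has_vector_derivative_def)
qed

text \<open>The second difference of \<open>F\<close> over the parallelogram spanned by \<open>h u\<close> and \<open>h v\<close>, divided by
  \<open>h\<^sup>2\<close>, is by the mean value theorem a value of the iterated derivative in either order.\<close>

lemma second_difference_mean_value:
  fixes F :: "'a::real_normed_vector \<Rightarrow> real"
  assumes "smooth_on X F" "ball p r \<subseteq> X" "h > 0" "h * (norm u + norm v) < r"
  shows "\<exists>q. dist q p \<le> h * (norm u + norm v) \<and>
    F (p + h *\<^sub>R u + h *\<^sub>R v) - F (p + h *\<^sub>R u) - F (p + h *\<^sub>R v) + F p
      = h * (h * dir_deriv v (dir_deriv u F) q)"
proof -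
  have near: "dist (p + s *\<^sub>R u + t *\<^sub>R v) p \<le> h * (norm u + norm v)"
    if "0 \<le> s" "s \<le> h" "0 \<le> t" "t \<le> h" for s t
  proof -
    have "dist (p + s *\<^sub>R u + t *\<^sub>R v) p = norm (s *\<^sub>R u + t *\<^sub>R v)"
      by (simp add: dist_norm add.assoc)
    also have "\<dots> \<le> norm (s *\<^sub>R u) + norm (t *\<^sub>R v)" by (rule norm_triangle_ineq)
    also have "\<dots> = s * norm u + t * norm v" using that by simp
    also have "\<dots> \<le> h * norm u + h * norm v" using that by (intro add_mono mult_right_mono) auto
    finally show ?thesis by (simp add: algebra_simps)
  qed
  have inX: "p + s *\<^sub>R u + t *\<^sub>R v \<in> X" if "0 \<le> s" "s \<le> h" "0 \<le> t" "t \<le> h" for s t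
    using near[OF that] assms(2,4) by (auto simp: subset_iff dist_commute)
  define G where "G = (\<lambda>s. F (p + s *\<^sub>R u + h *\<^sub>R v) - F (p + s *\<^sub>R u))"
  define G' where "G' = (\<lambda>s. dir_deriv u F (p + s *\<^sub>R u + h *\<^sub>R v) - dir_deriv u F (p + s *\<^sub>R u))"
  have dG: "(G has_real_derivative G' s) (at s)" if s: "0 \<le> s" "s \<le> h" for s
  proof -
    have 1: "p + s *\<^sub>R u \<in> X" using inX[of s 0] s assms(3) by simp
    have 2: "(p + h *\<^sub>R v) + s *\<^sub>R u \<in> X" using inX[of s h] s assms(3) by (simp add: algebra_simps)
    show ?thesis
      using DERIV_diff[OF smooth_on_along_line[OF assms(1) 2, folded has_real_derivative_iff_has_vector_derivative]
          smooth_on_along_line[OF assms(1) 1, folded has_real_derivative_iff_has_vector_derivative]]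
      by (simp add: G_def G'_def algebra_simps)
  qed
  obtain s where s: "0 < s" "s < h" "G h - G 0 = (h - 0) * G' s"
    using MVT2[OF assms(3) dG] by blast
  have dH: "((\<lambda>t. dir_deriv u F (p + s *\<^sub>R u + t *\<^sub>R v)) has_real_derivative
       dir_deriv v (dir_deriv u F) (p + s *\<^sub>R u + t *\<^sub>R v)) (at t)" if t: "0 \<le> t" "t \<le> h" for t
    unfolding has_real_derivative_iff_has_vector_derivative
    by (rule smooth_on_along_line[OF smooth_on_dir_deriv[OF assms(1)]]) (use inX[of s t] s t in auto)
  obtain t where t: "0 < t" "t < h" "G' s = (h - 0) * dir_deriv v (dir_deriv u F) (p + s *\<^sub>R u + t *\<^sub>R v)"
    using MVT2[OF assms(3) dH] unfolding G'_def by auto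
  have "G h - G 0 = h * (h * dir_deriv v (dir_deriv u F) (p + s *\<^sub>R u + t *\<^sub>R v))"
    using s t by simp
  then show ?thesis
    using near[of s t] s t by (intro exI[of _ "p + s *\<^sub>R u + t *\<^sub>R v"]) (auto simp: G_def)
qed

text \<open>Both iterated derivatives are limits of the same second difference quotient, because they are
  continuous.\<close>

lemma dir_deriv_commute_real:
  fixes F :: "'a::real_normed_vector \<Rightarrow> real"
  assumes "open X" "smooth_on X F" "p \<in> X"
  shows "dir_deriv v (dir_deriv u F) p = dir_deriv u (dir_deriv v F) p"
proof (rule ccontr)
  let ?A = "dir_deriv v (dir_deriv u F)" and ?B = "dir_deriv u (dir_deriv v F)"
  assume ne: "?A p \<noteq> ?B p"
  define e where "e = \<bar>?A p - ?B p\<bar> / 2"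
  have e: "e > 0" using ne by (simp add: e_def)
  have "isCont ?A p" "isCont ?B p"
    using assms smooth_on_imp_continuous_on[OF smooth_on_dir_deriv[OF smooth_on_dir_deriv[OF assms(2)]]]
    by (auto simp: continuous_on_eq_continuous_at)
  then obtain d1 d2 where d: "d1 > 0" "d2 > 0" "\<And>q. dist q p < d1 \<Longrightarrow> dist (?A q) (?A p) < e"
    "\<And>q. dist q p < d2 \<Longrightarrow> dist (?B q) (?B p) < e"
    using e unfolding continuous_at_eps_delta by blast
  obtain d3 where d3: "d3 > 0" "ball p d3 \<subseteq> X" using assms by (meson openE)
  define r where "r = min d1 (min d2 d3)"
  define h where "h = r / (2 * (norm u + norm v + 1))"
  have pos: "norm u + norm v + 1 > 0" by (simp add: add_nonneg_pos)
  have r: "r > 0" using d d3 by (simp add: r_def)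
  have h: "h > 0" using r pos by (simp add: h_def)
  have "h * (norm u + norm v) < h * (norm u + norm v + 1)" using h by simp
  also have "\<dots> = r / 2" using pos by (simp add: h_def field_simps)
  finally have hr: "h * (norm u + norm v) < r" using r by simp
  have "ball p r \<subseteq> X" using d3 by (auto simp: r_def)
  then obtain q q' where q: "dist q p \<le> h * (norm u + norm v)" "dist q' p \<le> h * (norm v + norm u)"
      "F (p + h *\<^sub>R u + h *\<^sub>R v) - F (p + h *\<^sub>R u) - F (p + h *\<^sub>R v) + F p = h * (h * ?A q)"
      "F (p + h *\<^sub>R v + h *\<^sub>R u) - F (p + h *\<^sub>R v) - F (p + h *\<^sub>R u) + F p = h * (h * ?B q')"
    using second_difference_mean_value[OF assms(2) _ h, of p r u v]
          second_difference_mean_value[OF assms(2) _ h, of p r v u] hr by (auto simp: add.commute)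
  have "p + h *\<^sub>R v + h *\<^sub>R u = p + h *\<^sub>R u + h *\<^sub>R v" by (simp add: algebra_simps)
  then have "F (p + h *\<^sub>R v + h *\<^sub>R u) = F (p + h *\<^sub>R u + h *\<^sub>R v)" by (rule arg_cong)
  with q(3,4) have "h * (h * ?A q) = h * (h * ?B q')" by linarith
  then have AB: "?A q = ?B q'" using h by simp
  have "dist (?A q) (?A p) < e" "dist (?B q') (?B p) < e"
    using q hr d(3)[of q] d(4)[of q'] by (auto simp: r_def add.commute)
  with AB have "\<bar>?A p - ?B p\<bar> < 2 * e" by (simp add: dist_real_def)
  then show False by (simp add: e_def)
qed

lemma dir_deriv_commute:
  fixes F :: "'a::real_normed_vector \<Rightarrow> 'b::real_inner"
  assumes "open X" "smooth_on X F" "p \<in> X"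
  shows "dir_deriv v (dir_deriv u F) p = dir_deriv u (dir_deriv v F) p"
proof -
  have d: "dir_deriv a (\<lambda>q. H q \<bullet> w) q = dir_deriv a H q \<bullet> w" if "smooth_on X H" "q \<in> X" for a H q and w :: 'b
    by (subst differential_eqI[OF has_derivative_inner_left[OF smooth_on_has_derivative[OF that]]]) simp
  have dd: "dir_deriv a (dir_deriv b (\<lambda>q. F q \<bullet> w)) p = dir_deriv a (dir_deriv b F) p \<bullet> w" for a b w
    by (subst differential_cong[OF assms(1,3), of _ "\<lambda>q. dir_deriv b F q \<bullet> w"])
       (simp_all add: d assms smooth_on_dir_deriv)
  have "dir_deriv v (dir_deriv u F) p \<bullet> w = dir_deriv u (dir_deriv v F) p \<bullet> w" for w
    unfolding dd[symmetric]
    by (rule dir_deriv_commute_real[OF assms(1) smooth_on_bounded_linear[OF assms(1) bounded_linear_inner_left assms(2)] assms(3)])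
  then show ?thesis using vector_eq_rdot by blast
qed


section \<open>Order of vanishing\<close>

text \<open>The derivatives of order less than \<open>k\<close> vanish at \<open>p\<close>. The order is counted by derivatives rather
  than by growth so that it passes to derivatives.\<close>

primrec vanishes :: "nat \<Rightarrow> 'a::real_normed_vector set \<Rightarrow> 'a \<Rightarrow> ('a \<Rightarrow> 'b::real_normed_vector) \<Rightarrow> bool" where
  "vanishes 0 X p F \<longleftrightarrow> smooth_on X F"
| "vanishes (Suc k) X p F \<longleftrightarrow> smooth_on X F \<and> F p = 0 \<and> (\<forall>v. vanishes k X p (dir_deriv v F))"

lemma vanishes_smooth: "vanishes k X p F \<Longrightarrow> smooth_on X F"
  by (cases k) auto

lemma vanishes_SucD: "vanishes (Suc k) X p F \<Longrightarrow> vanishes k X p F"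
  by (induction k arbitrary: F) auto

lemma vanishes_cong:
  assumes "open X" "p \<in> X" "\<And>q. q \<in> X \<Longrightarrow> F q = G q" "vanishes k X p F"
  shows "vanishes k X p G"
  using assms(3,4)
proof (induction k arbitrary: F G)
  case 0
  then show ?case using smooth_on_cong[OF assms(1)] by auto
next
  case (Suc k)
  have "vanishes k X p (dir_deriv v G)" for v
    by (rule Suc.IH[of "dir_deriv v F"])
       (use Suc.prems differential_cong[OF assms(1) _ Suc.prems(1)] in auto)
  moreover have "smooth_on X G"
    by (rule smooth_on_cong[OF assms(1) Suc.prems(1)]) (use Suc.prems(2) in simp_all)
  ultimately show ?case using Suc.prems assms(2) by auto
qed

lemma vanishes_bounded_linear:
  assumes "open X" "p \<in> X" "bounded_linear L" "vanishes k X p F"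
  shows "vanishes k X p (\<lambda>q. L (F q))"
  using assms(4)
proof (induction k arbitrary: F)
  case 0
  then show ?case using smooth_on_bounded_linear[OF assms(1,3)] by simp
next
  case (Suc k)
  have s: "smooth_on X F" using Suc.prems by simp
  have "vanishes k X p (dir_deriv v (\<lambda>q. L (F q)))" for v
  proof (rule vanishes_cong[OF assms(1,2)])
    show "vanishes k X p (\<lambda>q. L (dir_deriv v F q))" by (rule Suc.IH) (use Suc.prems in simp)
    show "L (dir_deriv v F q) = dir_deriv v (\<lambda>q. L (F q)) q" if "q \<in> X" for q
      by (subst differential_eqI[OF bounded_linear.has_derivative[OF assms(3)
          smooth_on_has_derivative[OF s that]]]) simp
  qed
  then show ?case
    using Suc.prems smooth_on_bounded_linear[OF assms(1,3) s] bounded_linear.linear[OF assms(3)] linear_0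
    by auto
qed

lemma vanishes_add:
  assumes "open X" "p \<in> X" "vanishes k X p F" "vanishes k X p G"
  shows "vanishes k X p (\<lambda>q. F q + G q)"
  using assms(3,4)
proof (induction k arbitrary: F G)
  case 0
  then show ?case using smooth_on_add[OF assms(1)] by simp
next
  case (Suc k)
  have s: "smooth_on X F" "smooth_on X G" using Suc.prems by simp_all
  have "vanishes k X p (dir_deriv v (\<lambda>q. F q + G q))" for v
  proof (rule vanishes_cong[OF assms(1,2)])
    show "vanishes k X p (\<lambda>q. dir_deriv v F q + dir_deriv v G q)"
      by (rule Suc.IH) (use Suc.prems in auto)
    show "dir_deriv v F q + dir_deriv v G q = dir_deriv v (\<lambda>q. F q + G q) q" if "q \<in> X" for q
      by (subst differential_eqI[OF has_derivative_add[OF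
          smooth_on_has_derivative[OF s(1) that] smooth_on_has_derivative[OF s(2) that]]]) simp
  qed
  then show ?case using Suc.prems smooth_on_add[OF assms(1) s] by auto
qed

lemma vanishes_zero: "vanishes k X p (\<lambda>_. 0)"
  by (induction k) (auto simp: smooth_on_const)

lemma vanishes_sum:
  assumes "open X" "p \<in> X" "finite I" "\<And>i. i \<in> I \<Longrightarrow> vanishes k X p (F i)"
  shows "vanishes k X p (\<lambda>q. \<Sum>i\<in>I. F i q)"
  using assms(3,4)
  by (induction I rule: finite_induct) (auto intro: vanishes_zero vanishes_add[OF assms(1,2)])

text \<open>Multiplication by a smooth factor does not lower the order. This is what lets a zeroth order
  term of a differential equation be neglected against its leading part.\<close>

lemma vanishes_bilinear:
  assumes "open X" "p \<in> X" "bounded_bilinear B" "vanishes k X p F" "smooth_on X G"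
  shows "vanishes k X p (\<lambda>q. B (F q) (G q))"
  using assms(4,5)
proof (induction k arbitrary: F G)
  case 0
  then show ?case using smooth_on_bilinear[OF assms(1,3)] by simp
next
  case (Suc k)
  have s: "smooth_on X F" using Suc.prems by simp
  have "vanishes k X p (dir_deriv v (\<lambda>q. B (F q) (G q)))" for v
  proof (rule vanishes_cong[OF assms(1,2)])
    show "vanishes k X p (\<lambda>q. B (F q) (dir_deriv v G q) + B (dir_deriv v F q) (G q))"
      using Suc.prems vanishes_SucD[OF Suc.prems(1)]
      by (intro vanishes_add assms(1,2) Suc.IH) (auto intro: smooth_on_dir_deriv)
    show "B (F q) (dir_deriv v G q) + B (dir_deriv v F q) (G q) = dir_deriv v (\<lambda>q. B (F q) (G q)) q"
      if "q \<in> X" for q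
      by (subst differential_eqI[OF bounded_bilinear.FDERIV[OF assms(3)
          smooth_on_has_derivative[OF s that] smooth_on_has_derivative[OF Suc.prems(2) that]]]) simp
  qed
  then show ?case
    using Suc.prems smooth_on_bilinear[OF assms(1,3) s Suc.prems(2)] bounded_bilinear.zero_left[OF assms(3)]
    by auto
qed

lemma differential_complex:
  fixes F :: "complex \<Rightarrow> 'b::real_normed_vector"
  assumes "F differentiable (at p)"
  shows "differential F p v = Re v *\<^sub>R differential F p 1 + Im v *\<^sub>R differential F p \<i>"
  using differential_in_basis[OF assms, of v] by (simp add: Basis_complex_def)

text \<open>Integration along the segment from \<open>p\<close> to \<open>z\<close> gains one power of the distance for each order.\<close>

lemma vanishes_bound:
  fixes F :: "complex \<Rightarrow> 'b::real_normed_vector"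
  assumes "open X" "p \<in> X" "vanishes k X p F"
  shows "\<exists>r>0. \<exists>K\<ge>0. cball p r \<subseteq> X \<and> (\<forall>z\<in>cball p r. norm (F z) \<le> K * dist z p ^ k)"
  using assms(3)
proof (induction k arbitrary: F)
  case 0
  obtain r where r: "r > 0" "cball p r \<subseteq> X" using assms(1,2) by (meson open_contains_cball)
  have "continuous_on (cball p r) F"
    using 0 r smooth_on_imp_continuous_on continuous_on_subset by fastforce
  then have "bounded (F ` cball p r)"
    by (intro compact_imp_bounded compact_continuous_image compact_cball)
  then obtain K where "\<forall>z\<in>cball p r. norm (F z) \<le> K" "K > 0" by (auto simp: bounded_pos)
  with r show ?case by (intro exI[of _ r] conjI exI[of _ K]) auto
next
  case (Suc k)
  obtain r1 K1 where 1: "r1 > 0" "K1 \<ge> 0" "cball p r1 \<subseteq> X"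
      "\<And>z. z \<in> cball p r1 \<Longrightarrow> norm (dir_deriv 1 F z) \<le> K1 * dist z p ^ k"
    using Suc.IH[of "dir_deriv 1 F"] Suc.prems by auto
  obtain r2 K2 where 2: "r2 > 0" "K2 \<ge> 0" "cball p r2 \<subseteq> X"
      "\<And>z. z \<in> cball p r2 \<Longrightarrow> norm (dir_deriv \<i> F z) \<le> K2 * dist z p ^ k"
    using Suc.IH[of "dir_deriv \<i> F"] Suc.prems by auto
  define r where "r = min r1 r2"
  have r: "r > 0" "cball p r \<subseteq> X" using 1 2 by (auto simp: r_def)
  have s: "smooth_on X F" and Fp: "F p = 0" using Suc.prems by simp_all
  have on: "onorm (differential F q) \<le> (K1 + K2) * dist q p ^ k" if q: "q \<in> cball p r" for q
  proof (rule onorm_bound)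
    show "0 \<le> (K1 + K2) * dist q p ^ k" using 1 2 by simp
    fix v :: complex
    have "q \<in> X" using q r by auto
    have "differential F q v = Re v *\<^sub>R dir_deriv 1 F q + Im v *\<^sub>R dir_deriv \<i> F q"
      by (rule differential_complex[OF smooth_onD_differentiable[OF s \<open>q \<in> X\<close>]])
    also have "norm \<dots> \<le> \<bar>Re v\<bar> * norm (dir_deriv 1 F q) + \<bar>Im v\<bar> * norm (dir_deriv \<i> F q)"
      by (rule order_trans[OF norm_triangle_ineq]) simp
    also have "\<dots> \<le> norm v * (K1 * dist q p ^ k) + norm v * (K2 * dist q p ^ k)"
      using 1(4)[of q] 2(4)[of q] q
      by (intro add_mono mult_mono) (auto simp: r_def abs_Re_le_cmod abs_Im_le_cmod)
    finally show "norm (differential F q v) \<le> (K1 + K2) * dist q p ^ k * norm v"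
      by (simp add: algebra_simps)
  qed
  have "norm (F z) \<le> (K1 + K2) * dist z p ^ Suc k" if z: "z \<in> cball p r" for z
  proof -
    have sub: "cball p (dist z p) \<subseteq> cball p r" using z by (auto simp: dist_commute)
    have "norm (F z - F p) \<le> (K1 + K2) * dist z p ^ k * norm (z - p)"
    proof (rule differentiable_bound[of "cball p (dist z p)" F "\<lambda>q. differential F q"])
      fix q assume q: "q \<in> cball p (dist z p)"
      then have "q \<in> X" using sub r by auto
      then show "(F has_derivative differential F q) (at q within cball p (dist z p))"
        using smooth_on_has_derivative[OF s] has_derivative_at_withinI by blast
      have "onorm (differential F q) \<le> (K1 + K2) * dist q p ^ k" using on q sub by auto
      also have "\<dots> \<le> (K1 + K2) * dist z p ^ k"
        using q 1 2 by (intro mult_left_mono power_mono) (auto simp: dist_commute)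
      finally show "onorm (differential F q) \<le> (K1 + K2) * dist z p ^ k" .
    qed (auto simp: dist_commute)
    then show ?thesis by (simp add: Fp dist_norm mult_ac)
  qed
  then show ?case using r 1 2 by (intro exI[of _ r] conjI exI[of _ "K1 + K2"]) auto
qed

section \<open>Cauchy--Riemann operators\<close>

text \<open>A complex Hermitian vector space, seen as a Euclidean space with the multiplication by the
  imaginary unit. Keeping \<open>J\<close> abstract allows \<open>J\<close> and \<open>- J\<close> to be treated at once.\<close>

locale orthogonal_complex_structure =
  fixes J :: "'v::euclidean_space \<Rightarrow> 'v"
  assumes linear_J: "linear J"
    and J_J: "J (J v) = - v"
    and J_isometry: "J u \<bullet> J v = u \<bullet> v"
begin

lemma bounded_linear_J: "bounded_linear J"
  by (rule linear_conv_bounded_linear[THEN iffD1, OF linear_J])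

lemma J_simps: "J (u + v) = J u + J v" "J (u - v) = J u - J v" "J (- v) = - J v"
    "J (a *\<^sub>R v) = a *\<^sub>R J v" "J 0 = 0"
  using linear_J by (simp_all add: linear_add linear_diff linear_neg linear_scale linear_0)

lemma norm_J: "norm (J v) = norm v"
  by (simp add: norm_eq_sqrt_inner J_isometry)

lemma J_inner_left: "J u \<bullet> v = - (u \<bullet> J v)"
  using J_isometry[of "J u" v] by (simp add: J_J)

lemma J_inner_self: "v \<bullet> J v = 0" "J v \<bullet> v = 0"
  using J_inner_left[of v v] by (simp_all add: inner_commute)

definition cmul :: "complex \<Rightarrow> 'v \<Rightarrow> 'v" where
  "cmul c v = Re c *\<^sub>R v + Im c *\<^sub>R J v"

lemma cmul_cmul: "cmul a (cmul b v) = cmul (a * b) v"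
  by (simp add: cmul_def J_simps J_J algebra_simps)

lemma cmul_1: "cmul 1 v = v"
  by (simp add: cmul_def)

lemma norm_cmul: "norm (cmul c v) = cmod c * norm v"
proof -
  have "cmul c v \<bullet> cmul c v = ((Re c)\<^sup>2 + (Im c)\<^sup>2) * (v \<bullet> v)"
    by (simp add: cmul_def inner_add_left inner_add_right J_isometry J_inner_self power2_eq_square algebra_simps)
  then show ?thesis
    unfolding norm_eq_sqrt_inner[of "cmul c v"] norm_eq_sqrt_inner[of v]
    by (simp add: cmod_def real_sqrt_mult)
qed

lemma cmul_scaleR: "cmul (a *\<^sub>R c) v = a *\<^sub>R cmul c v" "cmul c (a *\<^sub>R v) = a *\<^sub>R cmul c v"
  by (simp_all add: cmul_def J_simps algebra_simps)

lemma bounded_bilinear_cmul: "bounded_bilinear cmul"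
proof
  show "\<exists>K. \<forall>a b. norm (cmul a b) \<le> norm a * norm b * K"
    by (rule exI[of _ 1]) (simp add: norm_cmul)
qed (simp_all add: cmul_def J_simps algebra_simps)

text \<open>The Wirtinger derivatives of vector-valued functions, without the customary factor \<open>1/2\<close>.\<close>

definition dbar :: "(complex \<Rightarrow> 'v) \<Rightarrow> complex \<Rightarrow> 'v" where
  "dbar F z = dir_deriv 1 F z + J (dir_deriv \<i> F z)"

definition del :: "(complex \<Rightarrow> 'v) \<Rightarrow> complex \<Rightarrow> 'v" where
  "del F z = dir_deriv 1 F z - J (dir_deriv \<i> F z)"

lemma dir_derivs_from_del_dbar:
  "dir_deriv 1 F z = (1/2) *\<^sub>R (del F z + dbar F z)"
  "dir_deriv \<i> F z = (1/2) *\<^sub>R J (del F z - dbar F z)"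
proof -
  show "dir_deriv 1 F z = (1/2) *\<^sub>R (del F z + dbar F z)"
    by (simp add: del_def dbar_def flip: scaleR_2)
  have "del F z - dbar F z = - (2 *\<^sub>R J (dir_deriv \<i> F z))"
    by (simp add: del_def dbar_def scaleR_2)
  then show "dir_deriv \<i> F z = (1/2) *\<^sub>R J (del F z - dbar F z)"
    by (simp add: J_simps J_J)
qed

lemma vanishes_J: "open X \<Longrightarrow> p \<in> X \<Longrightarrow> vanishes k X p F \<Longrightarrow> vanishes k X p (\<lambda>z. J (F z))"
  by (rule vanishes_bounded_linear[OF _ _ bounded_linear_J])

lemma vanishes_scaleR: "open X \<Longrightarrow> p \<in> X \<Longrightarrow> vanishes k X p F \<Longrightarrow> vanishes k X p (\<lambda>z. a *\<^sub>R F z)"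
  for F :: "complex \<Rightarrow> 'v"
  by (rule vanishes_bounded_linear[OF _ _ bounded_linear_scaleR_right])

lemma vanishes_diff:
  fixes F G :: "complex \<Rightarrow> 'v"
  shows "open X \<Longrightarrow> p \<in> X \<Longrightarrow> vanishes k X p F \<Longrightarrow> vanishes k X p G \<Longrightarrow> vanishes k X p (\<lambda>z. F z - G z)"
  using vanishes_add[of X p k F "\<lambda>z. (-1) *\<^sub>R G z"] vanishes_scaleR[of X p k G "-1"] by simp

lemma vanishes_del_dbar:
  assumes "open X" "p \<in> X" "\<And>v. vanishes k X p (dir_deriv v F)"
  shows "vanishes k X p (del F)" "vanishes k X p (dbar F)"
  unfolding del_def[abs_def] dbar_def[abs_def]
  by (intro vanishes_add vanishes_diff vanishes_J assms)+

lemma smooth_on_del: "open X \<Longrightarrow> p \<in> X \<Longrightarrow> smooth_on X F \<Longrightarrow> smooth_on X (del F)"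
  and smooth_on_dbar: "open X \<Longrightarrow> p \<in> X \<Longrightarrow> smooth_on X F \<Longrightarrow> smooth_on X (dbar F)"
  using vanishes_del_dbar[of X p 0 F] smooth_on_dir_deriv by auto

lemma dir_deriv_del_dbar:
  assumes "smooth_on X F" "z \<in> X"
  shows "dir_deriv v (del F) z = dir_deriv v (dir_deriv 1 F) z - J (dir_deriv v (dir_deriv \<i> F) z)"
    "dir_deriv v (dbar F) z = dir_deriv v (dir_deriv 1 F) z + J (dir_deriv v (dir_deriv \<i> F) z)"
proof -
  have d: "(dir_deriv w F has_derivative differential (dir_deriv w F) z) (at z)" for w
    by (rule smooth_on_has_derivative[OF smooth_on_dir_deriv[OF assms(1)] assms(2)])
  note dJ = bounded_linear.has_derivative[OF bounded_linear_J d]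
  show "dir_deriv v (del F) z = dir_deriv v (dir_deriv 1 F) z - J (dir_deriv v (dir_deriv \<i> F) z)"
    unfolding del_def[abs_def] by (subst differential_eqI[OF has_derivative_diff[OF d dJ]]) simp
  show "dir_deriv v (dbar F) z = dir_deriv v (dir_deriv 1 F) z + J (dir_deriv v (dir_deriv \<i> F) z)"
    unfolding dbar_def[abs_def] by (subst differential_eqI[OF has_derivative_add[OF d dJ]]) simp
qed

lemma laplacian_factors:
  assumes "open X" "smooth_on X F" "z \<in> X"
  shows "dbar (del F) z = dir_deriv 1 (dir_deriv 1 F) z + dir_deriv \<i> (dir_deriv \<i> F) z"
    "del (dbar F) z = dir_deriv 1 (dir_deriv 1 F) z + dir_deriv \<i> (dir_deriv \<i> F) z"
  using dir_deriv_commute[OF assms, of 1 \<i>]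
  by (simp_all add: dbar_def[of "del F"] del_def[of "dbar F"] dir_deriv_del_dbar[OF assms(2,3)] J_simps J_J)

text \<open>The order of vanishing only needs to be tested on the pure \<open>del\<close>-derivatives if it is known for
  \<open>dbar F\<close>: as the two operators commute, any mixed derivative of \<open>F\<close> is a derivative of \<open>dbar F\<close>.\<close>

lemma vanishes_SucI:
  assumes "open X" "p \<in> X"
  shows "vanishes k X p F \<Longrightarrow> vanishes k X p (dbar F) \<Longrightarrow> (del ^^ k) F p = 0 \<Longrightarrow> vanishes (Suc k) X p F"
proof (induction k arbitrary: F)
  case 0
  then show ?case using smooth_on_dir_deriv by auto
next
  case (Suc k)
  have s: "smooth_on X F" and 0: "F p = 0" and d: "\<And>v. vanishes k X p (dir_deriv v F)"
    using Suc.prems by auto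
  have del: "vanishes (Suc k) X p (del F)"
  proof (rule Suc.IH)
    show "vanishes k X p (del F)" by (rule vanishes_del_dbar[OF assms d])
    have "vanishes k X p (del (dbar F))" by (rule vanishes_del_dbar[OF assms]) (use Suc.prems in simp)
    then show "vanishes k X p (dbar (del F))"
      by (rule vanishes_cong[OF assms, rotated]) (simp add: laplacian_factors[OF assms(1) s])
    show "(del ^^ k) (del F) p = 0" using Suc.prems(3) by (simp add: funpow_swap1)
  qed
  have d1: "vanishes (Suc k) X p (dir_deriv 1 F)"
    unfolding dir_derivs_from_del_dbar by (intro vanishes_scaleR vanishes_add assms del Suc.prems)
  have di: "vanishes (Suc k) X p (dir_deriv \<i> F)"
    unfolding dir_derivs_from_del_dbar by (intro vanishes_scaleR vanishes_diff vanishes_J assms del Suc.prems)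
  have "vanishes (Suc k) X p (dir_deriv v F)" for v
    by (rule vanishes_cong[OF assms, of "\<lambda>z. Re v *\<^sub>R dir_deriv 1 F z + Im v *\<^sub>R dir_deriv \<i> F z"])
       (simp add: differential_complex[OF smooth_onD_differentiable[OF s], of _ v],
        intro vanishes_scaleR vanishes_add assms d1 di)
  then show ?case using s 0 by simp
qed

lemma del_power_diff:
  assumes "open X" "z \<in> X"
  shows "smooth_on X F \<Longrightarrow> smooth_on X G \<Longrightarrow> (\<And>q. q \<in> X \<Longrightarrow> H q = F q - G q) \<Longrightarrow>
    (del ^^ k) H z = (del ^^ k) F z - (del ^^ k) G z"
proof (induction k arbitrary: F G H)
  case 0
  then show ?case using assms by simp
next
  case (Suc k)
  have "del H q = del F q - del G q" if q: "q \<in> X" for q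
  proof -
    have "dir_deriv v H q = dir_deriv v F q - dir_deriv v G q" for v
      by (subst differential_cong[OF assms(1) q Suc.prems(3)], assumption,
          subst differential_eqI[OF has_derivative_diff[OF
          smooth_on_has_derivative[OF Suc.prems(1) q] smooth_on_has_derivative[OF Suc.prems(2) q]]]) simp
    then show ?thesis by (simp add: del_def J_simps)
  qed
  then show ?case
    using Suc.IH[of "del F" "del G" "del H"] smooth_on_del[OF assms] Suc.prems
    by (simp add: funpow_swap1)
qed

lemma dir_deriv_monomial:
  "dir_deriv v (\<lambda>z. cmul ((z - p) ^ Suc k) c) z = cmul ((z - p) ^ k) (cmul (of_nat (Suc k) * v) c)"
proof -
  have "((\<lambda>z. (z - p) ^ Suc k) has_field_derivative of_nat (Suc k) * (z - p) ^ k) (at z)"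
    by (auto intro!: derivative_eq_intros simp del: power_Suc of_nat_Suc)
  then have "((\<lambda>z. (z - p) ^ Suc k) has_derivative (\<lambda>h. (of_nat (Suc k) * (z - p) ^ k) * h)) (at z)"
    by (simp only: has_field_derivative_def)
  from bounded_linear.has_derivative[OF bounded_bilinear.bounded_linear_left[OF bounded_bilinear_cmul] this]
  have "((\<lambda>z. cmul ((z - p) ^ Suc k) c) has_derivative (\<lambda>h. cmul ((of_nat (Suc k) * (z - p) ^ k) * h) c)) (at z)" .
  from differential_eqI[OF this]
  show ?thesis by (simp add: cmul_cmul mult_ac del: of_nat_Suc power_Suc)
qed

lemma differentiable_monomial: "(\<lambda>z. cmul ((z - p) ^ k) c) differentiable (at q)"
  by (rule differentiableI, rule bounded_linear.has_derivative[OF bounded_bilinear.bounded_linear_left[OF bounded_bilinear_cmul]])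
     (auto intro!: derivative_eq_intros)

lemma smooth_on_monomial: "smooth_on X (\<lambda>z. cmul ((z - p) ^ k) c)"
  unfolding smooth_on_def
proof
  fix n
  show "diff_order n X (\<lambda>z. cmul ((z - p) ^ k) c)"
  proof (induction n arbitrary: k c)
    case 0
    then show ?case
      using differentiable_imp_continuous_within[OF differentiable_monomial]
      by (auto intro!: continuous_at_imp_continuous_on)
  next
    case (Suc n)
    have "diff_order n X (dir_deriv v (\<lambda>z. cmul ((z - p) ^ k) c))" for v
    proof (cases k)
      case (Suc j)
      show ?thesis unfolding Suc dir_deriv_monomial by (rule Suc.IH)
    qed (simp add: diff_order_const)
    then show ?case by (simp add: differentiable_monomial)
  qed
qed

lemma vanishes_monomial: "vanishes k X p (\<lambda>z. cmul ((z - p) ^ k) c)"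
proof (induction k arbitrary: c)
  case 0
  then show ?case using smooth_on_monomial[of X p 0 c] by simp
next
  case (Suc k)
  have "vanishes k X p (dir_deriv v (\<lambda>z. cmul ((z - p) ^ Suc k) c))" for v
    unfolding dir_deriv_monomial by (rule Suc.IH)
  then show ?case using smooth_on_monomial[of X p "Suc k" c] by (simp add: cmul_def J_simps)
qed

lemma cmul_ii: "cmul (a * \<i>) v = J (cmul a v)" "cmul a (J v) = J (cmul a v)"
  by (simp_all add: cmul_def J_simps J_J)

lemma dbar_monomial: "dbar (\<lambda>z. cmul ((z - p) ^ k) c) = (\<lambda>_. 0)"
proof (cases k)
  case (Suc j)
  have "dbar (\<lambda>z. cmul ((z - p) ^ Suc j) c) z = 0" for z
    unfolding dbar_def dir_deriv_monomial
    by (simp add: cmul_cmul cmul_ii J_J flip: mult.assoc del: of_nat_Suc)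
  with Suc show ?thesis by blast
qed (simp add: dbar_def[abs_def] J_simps)

lemma del_monomial:
  "del (\<lambda>z. cmul ((z - p) ^ Suc k) c) = (\<lambda>z. cmul ((z - p) ^ k) ((2 * real (Suc k)) *\<^sub>R c))"
proof
  fix z
  have "del (\<lambda>z. cmul ((z - p) ^ Suc k) c) z = 2 *\<^sub>R cmul ((z - p) ^ k * of_nat (Suc k)) c"
    unfolding del_def dir_deriv_monomial
    by (simp add: cmul_cmul cmul_ii J_J scaleR_2 flip: mult.assoc del: of_nat_Suc)
  also have "(z - p) ^ k * of_nat (Suc k) = real (Suc k) *\<^sub>R (z - p) ^ k"
    by (simp add: scaleR_conv_of_real mult.commute)
  finally show "del (\<lambda>z. cmul ((z - p) ^ Suc k) c) z = cmul ((z - p) ^ k) ((2 * real (Suc k)) *\<^sub>R c)"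
    by (simp add: cmul_scaleR del: of_nat_Suc)
qed

text \<open>The normalisation \<open>del = 2 \<partial>/\<partial>z\<close> causes the power of two.\<close>

lemma del_power_monomial:
  "(del ^^ k) (\<lambda>z. cmul ((z - p) ^ k) c) z = (2 ^ k * fact k) *\<^sub>R c"
proof (induction k arbitrary: c)
  case (Suc k)
  have "(del ^^ Suc k) (\<lambda>z. cmul ((z - p) ^ Suc k) c) z
      = (del ^^ k) (\<lambda>z. cmul ((z - p) ^ k) ((2 * real (Suc k)) *\<^sub>R c)) z"
    unfolding funpow_Suc_right o_apply del_monomial ..
  also have "\<dots> = (2 ^ Suc k * fact (Suc k)) *\<^sub>R c"
    unfolding Suc.IH by (simp add: mult_ac)
  finally show ?case .
qed (simp add: cmul_1)

text \<open>The monomial \<open>P\<close> with the same \<open>k\<close>-th \<open>del\<close>-derivative as \<open>F\<close> is holomorphic, so \<open>F - P\<close>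
  vanishes to order \<open>k + 1\<close>, and near \<open>p\<close> it is smaller than \<open>P\<close>.\<close>

lemma isolated_zero_of_finite_order:
  assumes X: "open X" "p \<in> X" and F: "vanishes k X p F" "vanishes k X p (dbar F)" "(del ^^ k) F p \<noteq> 0"
  shows "\<exists>r>0. \<forall>z. 0 < dist z p \<longrightarrow> dist z p < r \<longrightarrow> F z \<noteq> 0"
proof -
  define c where "c = (1 / (2 ^ k * fact k)) *\<^sub>R (del ^^ k) F p"
  define P where "P = (\<lambda>z. cmul ((z - p) ^ k) c)"
  define H where "H = (\<lambda>z. F z - P z)"
  have P: "vanishes k X p P" "smooth_on X P" "(del ^^ k) P p = (del ^^ k) F p" "dbar P = (\<lambda>_. 0)"
    by (simp_all add: P_def vanishes_monomial smooth_on_monomial del_power_monomial dbar_monomial c_def)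
  have s: "smooth_on X F" using F(1) by (rule vanishes_smooth)
  have "vanishes (Suc k) X p H"
  proof (rule vanishes_SucI[OF X])
    show "vanishes k X p H" unfolding H_def by (intro vanishes_diff X F P)
    have "dbar F z = dbar H z" if "z \<in> X" for z
    proof -
      have "dir_deriv v H z = dir_deriv v F z - dir_deriv v P z" for v
        unfolding H_def
        by (subst differential_eqI[OF has_derivative_diff[OF
          smooth_on_has_derivative[OF s that] smooth_on_has_derivative[OF P(2) that]]]) simp
      then have "dbar H z = dbar F z - dbar P z" by (simp add: dbar_def J_simps)
      then show ?thesis by (simp add: P(4))
    qed
    from vanishes_cong[OF X this F(2)] show "vanishes k X p (dbar H)" .
    show "(del ^^ k) H p = 0"
      using del_power_diff[OF X s P(2), of H k] P(3) by (simp add: H_def)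
  qed
  then obtain r K where r: "r > 0" "K \<ge> 0" "\<And>z. z \<in> cball p r \<Longrightarrow> norm (H z) \<le> K * dist z p ^ Suc k"
    using vanishes_bound[OF X] by blast
  have c: "norm c > 0" using F(3) by (simp add: c_def)
  show ?thesis
  proof (intro exI conjI allI impI)
    show "min r (norm c / (K + 1)) > 0" using r c by simp
    fix z assume z: "0 < dist z p" "dist z p < min r (norm c / (K + 1))"
    have "dist z p * (K + 1) < norm c" using z r by (simp add: field_simps)
    then have "K * dist z p + dist z p < norm c" by (simp add: algebra_simps)
    then have "K * dist z p < norm c" using z(1) by linarith
    then have "K * dist z p ^ Suc k < norm c * dist z p ^ k"
      using z by (simp add: mult.assoc[symmetric])
    then have "norm (H z) < norm c * dist z p ^ k"
      using r(3)[of z] z by (simp add: dist_commute del: power_Suc)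
    also have "\<dots> = norm (P z)"
      by (simp add: P_def norm_cmul norm_power dist_norm mult.commute)
    finally have "norm (H z) < norm (P z)" .
    then show "F z \<noteq> 0" by (auto simp: H_def)
  qed
qed

lemma isolated_or_infinite_order_zero:
  assumes X: "open X" "p \<in> X" and F: "smooth_on X F"
    and dbar: "\<And>k. vanishes k X p F \<Longrightarrow> vanishes k X p (dbar F)"
  shows "(\<forall>k. vanishes k X p F) \<or> (\<exists>r>0. \<forall>z. 0 < dist z p \<longrightarrow> dist z p < r \<longrightarrow> F z \<noteq> 0)"
proof (cases "\<exists>k. vanishes k X p F \<and> (del ^^ k) F p \<noteq> 0")
  case True
  then show ?thesis using isolated_zero_of_finite_order[OF X] dbar by blast
next
  case False
  have "vanishes k X p F" for k
    by (induction k) (use F False vanishes_SucI[OF X] dbar in auto)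
  then show ?thesis by blast
qed

end


section \<open>Strong unique continuation\<close>

lemma second_derivative_nonpos_at_local_max:
  fixes f :: "real \<Rightarrow> real"
  assumes "\<epsilon> > 0" and f: "\<And>t. \<bar>t\<bar> < \<epsilon> \<Longrightarrow> (f has_real_derivative f' t) (at t)"
    and f': "(f' has_real_derivative c) (at 0)"
    and max: "\<And>t. \<bar>t\<bar> < \<epsilon> \<Longrightarrow> f t \<le> f 0"
  shows "c \<le> 0"
proof (rule ccontr)
  assume "\<not> c \<le> 0"
  have "f' 0 = 0"
    by (rule DERIV_local_max[OF f assms(1)]) (use assms(1) max in auto)
  with \<open>\<not> c \<le> 0\<close> obtain d where d: "d > 0" "\<And>h. 0 < h \<Longrightarrow> h < d \<Longrightarrow> 0 < f' h"
    using DERIV_pos_inc_right[OF f'] by auto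
  define t where "t = min d \<epsilon> / 2"
  have t: "0 < t" "t < d" "t < \<epsilon>" using d assms(1) by (auto simp: t_def)
  obtain x where x: "0 < x" "x < t" "f t - f 0 = (t - 0) * f' x"
    using MVT2[OF t(1), of f f'] f t by (metis abs_of_nonneg order_le_less_trans)
  have "f t - f 0 > 0" using x t d by simp
  then show False using max[of t] t by simp
qed

lemma square_completion_bound:
  fixes T e :: real
  shows "T\<^sup>2 - 2 * (e * T) \<ge> - e\<^sup>2"
  using zero_le_power2[of "T - e"] by (simp add: power2_diff algebra_simps)

context orthogonal_complex_structure
begin

text \<open>The pointwise inequality behind the lower bound of \<open>\<Delta> ln |W|\<^sup>2\<close>. Here \<open>P\<close> and \<open>Q\<close> stand for \<open>del W\<close>
  and \<open>dbar W\<close>, \<open>W1\<close> and \<open>W2\<close> for the partial derivatives and \<open>L\<close> for the Laplacian. Decompose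
  \<open>P\<close> into its part in the complex line of \<open>w\<close> and the rest \<open>T\<close>. The first part contributes to
  \<open>\<Delta> |W|\<^sup>2\<close> and to the squared gradient of \<open>|W|\<^sup>2\<close> the same terms, which cancel in the Laplacian of the
  logarithm because \<open>E\<close> is complex linear; this is essential, since no bound on \<open>P\<close> in terms
  of \<open>w\<close> is available. The part \<open>T\<close> enters as \<open>|T|\<^sup>2 / s\<close>, which absorbs the term linear in \<open>T\<close>.\<close>

lemma log_laplacian_algebra:
  assumes w: "w \<noteq> 0"
    and EJ: "\<And>v. E (J v) = J (E v)" and E: "linear E" and e: "\<And>v. norm (E v) \<le> e * norm v"
    and Q: "Q = E w" and L: "L = u + E P" and u: "norm u \<le> c * norm w"
    and W1: "W1 = (1/2) *\<^sub>R (P + Q)" and W2: "W2 = (1/2) *\<^sub>R J (P - Q)"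
  shows "2 * (W1 \<bullet> W1 + W2 \<bullet> W2 + w \<bullet> L) / (w \<bullet> w) - 4 * ((w \<bullet> W1)\<^sup>2 + (w \<bullet> W2)\<^sup>2) / (w \<bullet> w)\<^sup>2
     \<ge> - (e\<^sup>2 + 2 * c)"
proof -
  define s where "s = w \<bullet> w"
  have s: "s > 0" using w by (simp add: s_def)
  have sn: "s = norm w * norm w" by (simp add: s_def dot_square_norm power2_eq_square)
  have nw: "norm w > 0" using w by simp
  \<comment> \<open>Components of \<open>P\<close> and \<open>Q\<close> along the orthogonal vectors \<open>w\<close> and \<open>J w\<close> of square length \<open>s\<close>.\<close>
  define \<alpha> where "\<alpha> = (w \<bullet> P) / s"
  define \<beta> where "\<beta> = (J w \<bullet> P) / s"
  define T where "T = P - (\<alpha> *\<^sub>R w + \<beta> *\<^sub>R J w)"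
  define \<gamma> where "\<gamma> = (w \<bullet> Q) / s"
  define \<delta> where "\<delta> = (J w \<bullet> Q) / s"
  define T' where "T' = Q - (\<gamma> *\<^sub>R w + \<delta> *\<^sub>R J w)"
  have dots: "w \<bullet> P = \<alpha> * s" "J w \<bullet> P = \<beta> * s" "w \<bullet> Q = \<gamma> * s" "J w \<bullet> Q = \<delta> * s"
    using s by (simp_all add: \<alpha>_def \<beta>_def \<gamma>_def \<delta>_def)
  have JwJw: "J w \<bullet> J w = s" by (simp add: J_isometry s_def)
  have pythagoras: "v \<bullet> v = (a\<^sup>2 + b\<^sup>2) * s + (v - (a *\<^sub>R w + b *\<^sub>R J w)) \<bullet> (v - (a *\<^sub>R w + b *\<^sub>R J w))"
    if v: "w \<bullet> v = a * s" "J w \<bullet> v = b * s" for a b v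
  proof -
    have v': "v \<bullet> w = a * s" "v \<bullet> J w = b * s" using v by (simp_all add: inner_commute)
    show ?thesis
      by (simp add: inner_diff_left inner_diff_right inner_add_left inner_add_right JwJw J_inner_self s_def[symmetric] v v'
          power2_eq_square algebra_simps)
  qed
  have PP: "P \<bullet> P = (\<alpha>\<^sup>2 + \<beta>\<^sup>2) * s + T \<bullet> T"
    unfolding T_def by (rule pythagoras[OF dots(1,2)])
  have "Q \<bullet> Q = (\<gamma>\<^sup>2 + \<delta>\<^sup>2) * s + T' \<bullet> T'"
    unfolding T'_def by (rule pythagoras[OF dots(3,4)])
  then have QQ: "Q \<bullet> Q \<ge> (\<gamma>\<^sup>2 + \<delta>\<^sup>2) * s" by simp
  have sum2: "2 * (W1 \<bullet> W1 + W2 \<bullet> W2) = P \<bullet> P + Q \<bullet> Q"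
    by (simp add: W1 W2 J_isometry inner_add_left inner_add_right inner_diff_left inner_diff_right
        inner_commute[of Q P] field_simps)
  have JQ: "w \<bullet> J v = - (J w \<bullet> v)" for v using J_inner_left[of w v] by simp
  have "P = \<alpha> *\<^sub>R w + \<beta> *\<^sub>R J w + T" by (simp add: T_def)
  then have "E P = E (\<alpha> *\<^sub>R w + \<beta> *\<^sub>R J w + T)" by (rule arg_cong)
  also have "\<dots> = \<alpha> *\<^sub>R Q + \<beta> *\<^sub>R J Q + E T"
    by (simp add: Q EJ linear_add[OF E] linear_scale[OF E])
  finally have EP: "E P = \<alpha> *\<^sub>R Q + \<beta> *\<^sub>R J Q + E T" .
  have wEP: "w \<bullet> E P = \<alpha> * \<gamma> * s - \<beta> * \<delta> * s + w \<bullet> E T"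
    by (simp add: EP inner_add_right JQ dots)
  have "\<bar>w \<bullet> E T\<bar> \<le> norm w * norm (E T)" by (rule Cauchy_Schwarz_ineq2)
  also have "\<dots> \<le> norm w * (e * norm T)" using e by (intro mult_left_mono) auto
  finally have wET: "w \<bullet> E T \<ge> - (norm w * (e * norm T))" by linarith
  have "\<bar>w \<bullet> u\<bar> \<le> norm w * norm u" by (rule Cauchy_Schwarz_ineq2)
  also have "\<dots> \<le> norm w * (c * norm w)" using u by (intro mult_left_mono) auto
  finally have wu: "w \<bullet> u \<ge> - c * s" by (simp add: sn mult_ac)
  have wL: "w \<bullet> L \<ge> - c * s + \<alpha> * \<gamma> * s - \<beta> * \<delta> * s - norm w * (e * norm T)"
    using wu wET by (simp add: L inner_add_right wEP)
  have wW: "4 * (w \<bullet> W1)\<^sup>2 = ((\<alpha> + \<gamma>) * s)\<^sup>2" "4 * (w \<bullet> W2)\<^sup>2 = ((\<beta> - \<delta>) * s)\<^sup>2"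
    by (simp_all add: W1 W2 JQ inner_add_right inner_diff_right dots power2_eq_square algebra_simps)
  have TT: "T \<bullet> T = (norm T)\<^sup>2" by (simp add: dot_square_norm)
  have "2 * (W1 \<bullet> W1 + W2 \<bullet> W2 + w \<bullet> L)
      \<ge> ((\<alpha> + \<gamma>)\<^sup>2 + (\<beta> - \<delta>)\<^sup>2) * s - 2 * c * s + (norm T)\<^sup>2 - 2 * ((norm w * e) * norm T)"
    using sum2 PP QQ wL TT by (simp add: power2_eq_square algebra_simps)
  moreover have "(norm T)\<^sup>2 - 2 * ((norm w * e) * norm T) \<ge> - (e\<^sup>2 * s)"
    using square_completion_bound[of "norm w * e" "norm T"] by (simp add: sn power2_eq_square mult_ac)
  ultimately have "2 * (W1 \<bullet> W1 + W2 \<bullet> W2 + w \<bullet> L)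
      \<ge> ((\<alpha> + \<gamma>)\<^sup>2 + (\<beta> - \<delta>)\<^sup>2) * s - (e\<^sup>2 + 2 * c) * s"
    by (simp add: algebra_simps)
  then have "2 * (W1 \<bullet> W1 + W2 \<bullet> W2 + w \<bullet> L) / s
      \<ge> (((\<alpha> + \<gamma>)\<^sup>2 + (\<beta> - \<delta>)\<^sup>2) * s - (e\<^sup>2 + 2 * c) * s) / s"
    using s by (intro divide_right_mono) auto
  moreover have "(((\<alpha> + \<gamma>)\<^sup>2 + (\<beta> - \<delta>)\<^sup>2) * s - (e\<^sup>2 + 2 * c) * s) / s
      = (\<alpha> + \<gamma>)\<^sup>2 + (\<beta> - \<delta>)\<^sup>2 - (e\<^sup>2 + 2 * c)"
    using s by (simp add: field_simps)
  moreover have "4 * ((w \<bullet> W1)\<^sup>2 + (w \<bullet> W2)\<^sup>2) / s\<^sup>2 = (\<alpha> + \<gamma>)\<^sup>2 + (\<beta> - \<delta>)\<^sup>2"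
    using s by (simp add: distrib_left wW power_mult_distrib add_divide_distrib)
  ultimately show ?thesis by (simp add: s_def[symmetric])
qed

end

locale cauchy_riemann_system = orthogonal_complex_structure J
  for J :: "'v::euclidean_space \<Rightarrow> 'v" +
  fixes X :: "complex set" and E :: "complex \<Rightarrow> 'v \<Rightarrow> 'v" and W :: "complex \<Rightarrow> 'v"
  assumes open_X: "open X"
    and linear_E: "z \<in> X \<Longrightarrow> linear (E z)"
    and smooth_E: "smooth_on X (\<lambda>z. E z v)"
    and E_J: "z \<in> X \<Longrightarrow> E z (J v) = J (E z v)"
    and smooth_W: "smooth_on X W"
    and equation: "z \<in> X \<Longrightarrow> dbar W z = E z (W z)"
begin

lemma E_in_basis: "z \<in> X \<Longrightarrow> E z v = (\<Sum>b\<in>Basis. (v \<bullet> b) *\<^sub>R E z b)"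
proof -
  assume z: "z \<in> X"
  have "E z v = E z (\<Sum>b\<in>Basis. (v \<bullet> b) *\<^sub>R b)" by (simp add: euclidean_representation)
  then show ?thesis by (simp add: linear_sum[OF linear_E[OF z]] linear_scale[OF linear_E[OF z]])
qed

text \<open>The derivative of the coefficient \<open>E\<close> in direction \<open>h\<close>, defined through basis vectors so that only
  the smoothness of each \<open>E _ v\<close> is used.\<close>

definition DE :: "complex \<Rightarrow> complex \<Rightarrow> 'v \<Rightarrow> 'v" where
  "DE h z v = (\<Sum>b\<in>Basis. (v \<bullet> b) *\<^sub>R dir_deriv h (\<lambda>q. E q b) z)"

lemma dir_deriv_equation:
  assumes "z \<in> X"
  shows "dir_deriv h (dbar W) z = DE h z (W z) + E z (dir_deriv h W z)"
proof -
  have "((\<lambda>q. \<Sum>b\<in>Basis. (W q \<bullet> b) *\<^sub>R E q b) has_derivative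
      (\<lambda>v. \<Sum>b\<in>Basis. (W z \<bullet> b) *\<^sub>R differential (\<lambda>q. E q b) z v + (differential W z v \<bullet> b) *\<^sub>R E z b)) (at z)"
    by (intro has_derivative_sum has_derivative_scaleR has_derivative_inner_left
        smooth_on_has_derivative[OF _ assms] smooth_W smooth_E)
  from differential_eqI[OF this]
  have "dir_deriv h (\<lambda>q. \<Sum>b\<in>Basis. (W q \<bullet> b) *\<^sub>R E q b) z = DE h z (W z) + E z (dir_deriv h W z)"
    by (simp add: sum.distrib DE_def E_in_basis[OF assms, of "dir_deriv h W z"])
  moreover have "dbar W q = (\<Sum>b\<in>Basis. (W q \<bullet> b) *\<^sub>R E q b)" if "q \<in> X" for q
    using equation[OF that] E_in_basis[OF that, of "W q"] by simp
  ultimately show ?thesis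
    using differential_cong[OF open_X assms, of "dbar W" "\<lambda>q. \<Sum>b\<in>Basis. (W q \<bullet> b) *\<^sub>R E q b"] by simp
qed

text \<open>Apply \<open>del\<close> to the equation \<open>dbar W = E W\<close>. That \<open>E\<close> commutes with \<open>J\<close> brings the derivatives of
  \<open>W\<close> together as \<open>E (del W)\<close>.\<close>

lemma laplacian_W:
  assumes "z \<in> X"
  shows "dir_deriv 1 (dir_deriv 1 W) z + dir_deriv \<i> (dir_deriv \<i> W) z
     = (DE 1 z (W z) - J (DE \<i> z (W z))) + E z (del W z)"
  unfolding laplacian_factors(2)[OF open_X smooth_W assms, symmetric]
  by (simp add: del_def dir_deriv_equation[OF assms] J_simps linear_diff[OF linear_E[OF assms]] E_J[OF assms])

lemma log_laplacian_bound:
  assumes z: "z \<in> X" "W z \<noteq> 0" and e: "\<And>v. norm (E z v) \<le> e * norm v"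
    and c: "\<And>v. norm (DE 1 z v) + norm (DE \<i> z v) \<le> c * norm v"
  shows "2 * (dir_deriv 1 W z \<bullet> dir_deriv 1 W z + dir_deriv \<i> W z \<bullet> dir_deriv \<i> W z
        + W z \<bullet> (dir_deriv 1 (dir_deriv 1 W) z + dir_deriv \<i> (dir_deriv \<i> W) z)) / (W z \<bullet> W z)
      - 4 * ((W z \<bullet> dir_deriv 1 W z)\<^sup>2 + (W z \<bullet> dir_deriv \<i> W z)\<^sup>2) / (W z \<bullet> W z)\<^sup>2
     \<ge> - (e\<^sup>2 + 2 * c)"
proof (rule log_laplacian_algebra[OF z(2), of "E z" e _ _ "DE 1 z (W z) - J (DE \<i> z (W z))" "del W z"])
  show "E z (J v) = J (E z v)" for v by (rule E_J[OF z(1)])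
  show "dir_deriv 1 W z = (1/2) *\<^sub>R (del W z + dbar W z)" "dir_deriv \<i> W z = (1/2) *\<^sub>R J (del W z - dbar W z)"
    by (rule dir_derivs_from_del_dbar)+
  show "dbar W z = E z (W z)" by (rule equation[OF z(1)])
  show "norm (DE 1 z (W z) - J (DE \<i> z (W z))) \<le> c * norm (W z)"
    using norm_triangle_ineq4[of "DE 1 z (W z)" "J (DE \<i> z (W z))"] c[of "W z"] by (simp add: norm_J)
qed (simp_all add: linear_E[OF z(1)] e laplacian_W[OF z(1)])

text \<open>At a local maximum the second derivatives in both coordinate directions are nonpositive. Their
  sum is at least \<open>4 N - (e\<^sup>2 + 2 c) > 0\<close>, as \<open>ln |z - p|\<^sup>2\<close> is harmonic.\<close>

lemma no_local_max:
  assumes z: "z \<in> X" "W z \<noteq> 0" "z \<noteq> p" and e: "\<And>v. norm (E z v) \<le> e * norm v"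
    and c: "\<And>v. norm (DE 1 z v) + norm (DE \<i> z v) \<le> c * norm v"
    and N: "4 * N > e\<^sup>2 + 2 * c"
    and r: "r > 0"
    and max: "\<And>q. dist q z < r \<Longrightarrow> q \<in> X \<Longrightarrow> W q \<noteq> 0 \<Longrightarrow> q \<noteq> p \<Longrightarrow>
      ln (W q \<bullet> W q) + N * (dist q p)\<^sup>2 - real k * ln ((dist q p)\<^sup>2)
      \<le> ln (W z \<bullet> W z) + N * (dist z p)\<^sup>2 - real k * ln ((dist z p)\<^sup>2)"
  shows False
proof -
  define Y where "Y = (X \<inter> W -` (- {0})) - {p}"
  have "open (X \<inter> W -` (- {0}))"
    by (rule continuous_open_preimage[OF smooth_on_imp_continuous_on[OF smooth_W] open_X]) auto
  then have "open Y" unfolding Y_def by (intro open_Diff) auto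
  moreover have "z \<in> Y" using z by (simp add: Y_def)
  ultimately obtain \<rho> where \<rho>: "\<rho> > 0" "ball z \<rho> \<subseteq> Y" by (meson openE)
  define \<epsilon> where "\<epsilon> = min r \<rho>"
  have \<epsilon>: "\<epsilon> > 0" using r \<rho> by (simp add: \<epsilon>_def)
  let ?n0 = "(dist z p)\<^sup>2" and ?s = "W z \<bullet> W z"
  have dir: "2 * (dir_deriv v W z \<bullet> dir_deriv v W z + W z \<bullet> dir_deriv v (dir_deriv v W) z) / ?s
      - 4 * (W z \<bullet> dir_deriv v W z)\<^sup>2 / ?s\<^sup>2
      + 2 * N - real k * (2 / ?n0 - 4 * ((z - p) \<bullet> v)\<^sup>2 / ?n0\<^sup>2) \<le> 0" if v: "norm v = 1" for v
  proof -
    define m where "m = (z - p) \<bullet> v"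
    define n where "n = (\<lambda>t. ?n0 + 2 * m * t + t\<^sup>2)"
    define w where "w = (\<lambda>t. W (z + t *\<^sub>R v))"
    define w' where "w' = (\<lambda>t. dir_deriv v W (z + t *\<^sub>R v))"
    define w'' where "w'' = dir_deriv v (dir_deriv v W) z"
    define \<phi> where "\<phi> = (\<lambda>t. ln (w t \<bullet> w t) + N * n t - real k * ln (n t))"
    define \<phi>' where "\<phi>' = (\<lambda>t. 2 * (w t \<bullet> w' t) / (w t \<bullet> w t) + N * (2 * m + 2 * t) - real k * ((2 * m + 2 * t) / n t))"
    have vv: "v \<bullet> v = 1" using v by (simp add: dot_square_norm)
    have n: "n t = (dist (z + t *\<^sub>R v) p)\<^sup>2" for t
    proof -
      have "(dist (z + t *\<^sub>R v) p)\<^sup>2 = (z - p + t *\<^sub>R v) \<bullet> (z - p + t *\<^sub>R v)"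
        by (simp add: dist_norm dot_square_norm algebra_simps)
      also have "\<dots> = (z - p) \<bullet> (z - p) + 2 * m * t + t\<^sup>2"
        by (simp only: inner_add_left inner_add_right inner_scaleR_left inner_scaleR_right
            inner_commute[of v "z - p"] vv m_def[symmetric]) (simp add: power2_eq_square algebra_simps)
      finally show ?thesis by (simp add: n_def dist_norm dot_square_norm)
    qed
    have inY: "z + t *\<^sub>R v \<in> Y" if "\<bar>t\<bar> < \<epsilon>" for t
      using that \<rho> v by (auto simp: \<epsilon>_def dist_norm subset_iff)
    have dn: "(n has_real_derivative 2 * m + 2 * t) (at t)" for t
      unfolding n_def by (auto intro!: derivative_eq_intros)
    have dw: "(w has_vector_derivative w' t) (at t)" if "\<bar>t\<bar> < \<epsilon>" for t
      unfolding w_def w'_def by (rule smooth_on_along_line[OF smooth_W]) (use inY[OF that] in \<open>simp add: Y_def\<close>)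
    have dw': "(w' has_vector_derivative w'') (at 0)"
      using smooth_on_along_line[OF smooth_on_dir_deriv[OF smooth_W], of z 0 v v] z(1)
      unfolding w'_def w''_def by simp
    have dww: "((\<lambda>t. w t \<bullet> w t) has_real_derivative 2 * (w t \<bullet> w' t)) (at t)" if "\<bar>t\<bar> < \<epsilon>" for t
      using bounded_bilinear.has_vector_derivative[OF bounded_bilinear_inner dw[OF that] dw[OF that]]
      by (simp add: has_real_derivative_iff_has_vector_derivative inner_commute)
    have dww': "((\<lambda>t. w t \<bullet> w' t) has_real_derivative (w 0 \<bullet> w'' + w' 0 \<bullet> w' 0)) (at 0)"
      using bounded_bilinear.has_vector_derivative[OF bounded_bilinear_inner dw[of 0] dw'] \<epsilon>
      by (simp add: has_real_derivative_iff_has_vector_derivative)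
    have pos: "w t \<bullet> w t > 0" "n t > 0" if "\<bar>t\<bar> < \<epsilon>" for t
      using inY[OF that] by (auto simp: Y_def w_def n)
    have d1: "(\<phi> has_real_derivative \<phi>' t) (at t)" if t: "\<bar>t\<bar> < \<epsilon>" for t
      unfolding \<phi>_def \<phi>'_def
      by (rule derivative_eq_intros dww[OF t] dn refl pos[OF t])+ (simp add: field_simps)
    have 0: "\<bar>0::real\<bar> < \<epsilon>" using \<epsilon> by simp
    have nz: "w 0 \<bullet> w 0 \<noteq> 0" "n 0 \<noteq> 0" using pos[OF 0] by auto
    have d2: "(\<phi>' has_real_derivative
        2 * (w' 0 \<bullet> w' 0 + w 0 \<bullet> w'') / (w 0 \<bullet> w 0) - 4 * (w 0 \<bullet> w' 0)\<^sup>2 / (w 0 \<bullet> w 0)\<^sup>2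
        + 2 * N - real k * (2 / n 0 - 4 * m\<^sup>2 / (n 0)\<^sup>2)) (at 0)"
      unfolding \<phi>'_def
      by (rule derivative_eq_intros dww[OF 0] dww' dn refl nz)+
         (use nz in \<open>simp add: power2_eq_square diff_divide_distrib add_divide_distrib algebra_simps\<close>)
    have "\<phi> t \<le> \<phi> 0" if "\<bar>t\<bar> < \<epsilon>" for t
    proof -
      have "dist (z + t *\<^sub>R v) z < r" using that v by (simp add: \<epsilon>_def dist_norm)
      then show ?thesis
        using max[of "z + t *\<^sub>R v"] inY[OF that] by (simp add: \<phi>_def w_def n Y_def)
    qed
    from second_derivative_nonpos_at_local_max[OF \<epsilon> d1 d2 this]
    show ?thesis by (simp add: w_def w'_def w''_def m_def n)
  qed
  have n0: "?n0 > 0" using z by simp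
  have "((z - p) \<bullet> 1)\<^sup>2 + ((z - p) \<bullet> \<i>)\<^sup>2 = ?n0"
    by (simp add: dist_norm cmod_def inner_complex_def)
  then have m: "4 * ((z - p) \<bullet> 1)\<^sup>2 / ?n0\<^sup>2 + 4 * ((z - p) \<bullet> \<i>)\<^sup>2 / ?n0\<^sup>2 = 4 / ?n0"
    using n0 by (simp only: add_divide_distrib[symmetric] distrib_left[symmetric]) (simp add: power2_eq_square)
  have "(2 / ?n0 - 4 * ((z - p) \<bullet> 1)\<^sup>2 / ?n0\<^sup>2) + (2 / ?n0 - 4 * ((z - p) \<bullet> \<i>)\<^sup>2 / ?n0\<^sup>2) = 0"
    using m by simp
  then have k0: "real k * (2 / ?n0 - 4 * ((z - p) \<bullet> 1)\<^sup>2 / ?n0\<^sup>2) + real k * (2 / ?n0 - 4 * ((z - p) \<bullet> \<i>)\<^sup>2 / ?n0\<^sup>2) = 0"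
    by (simp only: distrib_left[symmetric] mult_zero_right)
  have "- (e\<^sup>2 + 2 * c) + 4 * N \<le> 0"
    using add_mono[OF dir[of 1] dir[of \<i>]] k0 log_laplacian_bound[OF z(1,2) e c]
    by (simp add: inner_add_right distrib_left add_divide_distrib algebra_simps)
  then show False using N by simp
qed

lemma coefficient_bounds:
  assumes K: "compact K" "K \<subseteq> X"
  shows "\<exists>e c. \<forall>z\<in>K. \<forall>v. norm (E z v) \<le> e * norm v \<and> norm (DE 1 z v) + norm (DE \<i> z v) \<le> c * norm v"
proof -
  have bound: "\<exists>B. \<forall>z\<in>K. \<forall>v. norm (\<Sum>b\<in>Basis. (v \<bullet> b) *\<^sub>R A b z) \<le> B * norm v"
    if A: "\<And>b. smooth_on X (A b)" for A :: "'v \<Rightarrow> complex \<Rightarrow> 'v"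
  proof -
    have "\<exists>B. \<forall>z\<in>K. norm (A b z) \<le> B" for b
    proof -
      have "bounded (A b ` K)"
        using A K continuous_on_subset smooth_on_imp_continuous_on
        by (intro compact_imp_bounded compact_continuous_image) blast+
      then show ?thesis by (auto simp: bounded_iff)
    qed
    then obtain B where B: "\<And>b z. z \<in> K \<Longrightarrow> norm (A b z) \<le> B b" by metis
    have "norm (\<Sum>b\<in>Basis. (v \<bullet> b) *\<^sub>R A b z) \<le> (\<Sum>b\<in>Basis. B b) * norm v" if "z \<in> K" for z v
    proof -
      have "norm (\<Sum>b\<in>Basis. (v \<bullet> b) *\<^sub>R A b z) \<le> (\<Sum>b\<in>Basis. norm ((v \<bullet> b) *\<^sub>R A b z))"
        by (rule norm_sum)
      also have "\<dots> \<le> (\<Sum>b\<in>Basis. norm v * B b)"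
        using B[OF that] by (intro sum_mono) (auto intro!: mult_mono Basis_le_norm)
      finally show ?thesis by (simp add: sum_distrib_left mult.commute)
    qed
    then show ?thesis by blast
  qed
  obtain e where e: "\<And>z v. z \<in> K \<Longrightarrow> norm (\<Sum>b\<in>Basis. (v \<bullet> b) *\<^sub>R E z b) \<le> e * norm v"
    using bound[of "\<lambda>b z. E z b"] smooth_E by blast
  obtain c1 where c1: "\<And>z v. z \<in> K \<Longrightarrow> norm (DE 1 z v) \<le> c1 * norm v"
    using bound[of "\<lambda>b. dir_deriv 1 (\<lambda>q. E q b)"] smooth_on_dir_deriv[OF smooth_E] unfolding DE_def by blast
  obtain c2 where c2: "\<And>z v. z \<in> K \<Longrightarrow> norm (DE \<i> z v) \<le> c2 * norm v"
    using bound[of "\<lambda>b. dir_deriv \<i> (\<lambda>q. E q b)"] smooth_on_dir_deriv[OF smooth_E] unfolding DE_def by blast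
  have "norm (E z v) \<le> e * norm v \<and> norm (DE 1 z v) + norm (DE \<i> z v) \<le> (c1 + c2) * norm v"
    if "z \<in> K" for z v
    using e[OF that, of v] c1[OF that, of v] c2[OF that, of v] E_in_basis[of z v] K that
    by (auto simp: distrib_right)
  then show ?thesis by blast
qed

text \<open>The exponential \<open>Q k\<close> of the subharmonic function is maximised over an annulus. Its inner radius
  is chosen so small that, by vanishing of order \<open>k + 1\<close>, \<open>Q k\<close> is smaller there than at a given point \<open>z1\<close>;
  interior maxima are excluded by \<open>no_local_max\<close>. So the maximum sits on the outer circle, where
  \<open>Q k\<close> is at most a constant times \<open>R\<close> to the power \<open>- 2 k\<close>.\<close>

theorem strong_unique_continuation:
  assumes p: "p \<in> X" and flat: "\<And>k. vanishes k X p W"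
  shows "\<exists>R>0. \<forall>z\<in>ball p R. W z = 0"
proof -
  obtain R where R: "R > 0" "cball p R \<subseteq> X" using open_X p by (meson open_contains_cball)
  have cont: "continuous_on (cball p R) W"
    using smooth_on_imp_continuous_on[OF smooth_W] R continuous_on_subset by blast
  obtain e c where ec: "\<And>z v. z \<in> cball p R \<Longrightarrow> norm (E z v) \<le> e * norm v"
      "\<And>z v. z \<in> cball p R \<Longrightarrow> norm (DE 1 z v) + norm (DE \<i> z v) \<le> c * norm v"
    using coefficient_bounds[OF compact_cball R(2)] by blast
  \<comment> \<open>The constant must not depend on \<open>k\<close>; nonnegativity is used to estimate the exponential.\<close>
  define N where "N = max 0 ((e\<^sup>2 + 2 * c) / 4 + 1)"
  have N: "4 * N > e\<^sup>2 + 2 * c" "N \<ge> 0" by (auto simp: N_def max_def field_simps)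
  define Q where "Q = (\<lambda>k z. (W z \<bullet> W z) * exp (N * (dist z p)\<^sup>2) / ((dist z p)\<^sup>2) ^ k)"
  have "bounded ((\<lambda>z. W z \<bullet> W z) ` cball p R)"
    by (intro compact_imp_bounded compact_continuous_image compact_cball continuous_on_inner cont)
  then obtain C where C: "\<And>z. z \<in> cball p R \<Longrightarrow> W z \<bullet> W z \<le> C"
    by (force simp: bounded_iff)
  have Wp: "W p = 0" using flat[of 1] by simp
  have main: "Q k z1 \<le> C * exp (N * R\<^sup>2) / (R\<^sup>2) ^ k" if z1: "z1 \<in> ball p R" "W z1 \<noteq> 0" for k z1
  proof -
    have d1: "0 < dist z1 p" "dist z1 p < R" using z1 Wp by (auto simp: dist_commute)
    have Q1: "Q k z1 > 0" using d1 z1 by (simp add: Q_def)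
    obtain r K where r: "r > 0" "K \<ge> 0" "\<And>z. z \<in> cball p r \<Longrightarrow> norm (W z) \<le> K * dist z p ^ Suc k"
      using vanishes_bound[OF open_X p flat[of "Suc k"]] by blast
    define B where "B = K\<^sup>2 * exp N + 1"
    have B: "B > 0" by (simp add: B_def add_nonneg_pos)
    define r0 where "r0 = min (min 1 r) (min (dist z1 p) (Q k z1 / (2 * B)))"
    have r0: "0 < r0" "r0 \<le> 1" "r0 \<le> r" "r0 \<le> dist z1 p" "r0 \<le> Q k z1 / (2 * B)"
      using r d1 Q1 B by (auto simp: r0_def)
    have small: "Q k z < Q k z1" if z: "dist z p = r0" for z
    proof -
      have "W z \<bullet> W z = (norm (W z))\<^sup>2" by (simp add: dot_square_norm)
      also have "\<dots> \<le> (K * r0 ^ Suc k)\<^sup>2"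
        using r(3)[of z] z r0 by (intro power_mono) (auto simp: dist_commute)
      also have "\<dots> = K\<^sup>2 * r0\<^sup>2 * (r0\<^sup>2) ^ k"
        by (simp add: power_mult_distrib power_mult[symmetric] mult.commute)
      finally have "W z \<bullet> W z \<le> K\<^sup>2 * r0\<^sup>2 * (r0\<^sup>2) ^ k" .
      moreover have "N * r0\<^sup>2 \<le> N" using N r0 by (simp add: mult_left_le power_le_one)
      ultimately have "Q k z \<le> (K\<^sup>2 * r0\<^sup>2 * (r0\<^sup>2) ^ k) * exp N / (r0\<^sup>2) ^ k"
        unfolding Q_def z using r0 by (intro divide_right_mono mult_mono) auto
      also have "\<dots> = (K\<^sup>2 * exp N) * r0\<^sup>2" using r0 by simp
      also have "\<dots> \<le> B * r0"
        using r0 by (intro mult_mono) (auto simp: B_def power2_eq_square mult_left_le)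
      also have "\<dots> \<le> Q k z1 / 2" using r0(5) B by (simp add: field_simps)
      also have "\<dots> < Q k z1" using Q1 by simp
      finally show ?thesis .
    qed
    define A where "A = cball p R - ball p r0"
    have A: "z \<in> A \<longleftrightarrow> r0 \<le> dist z p \<and> dist z p \<le> R" for z by (auto simp: A_def dist_commute)
    have "compact A" unfolding A_def by (intro compact_diff compact_cball open_ball)
    moreover have "A \<noteq> {}" using A[of z1] r0 d1 by auto
    moreover have "continuous_on A (Q k)"
      unfolding Q_def
      by (intro continuous_intros continuous_on_subset[OF cont]) (use A r0 in \<open>auto simp: A_def\<close>)
    ultimately have "\<exists>z\<in>A. \<forall>q\<in>A. Q k q \<le> Q k z"
      by (rule continuous_attains_sup)
    then obtain z where z: "z \<in> A" "\<And>q. q \<in> A \<Longrightarrow> Q k q \<le> Q k z" by auto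
    have ge: "Q k z1 \<le> Q k z" using z(2)[of z1] A r0 d1 by auto
    have zA: "r0 \<le> dist z p" "dist z p \<le> R" using z(1) A by simp_all
    moreover have "dist z p \<noteq> r0" using small[of z] ge by linarith
    ultimately have zd: "r0 < dist z p" "dist z p \<le> R" by simp_all
    have "dist z p = R"
    proof (rule ccontr)
      assume "dist z p \<noteq> R"
      with zd have zR: "dist z p < R" by simp
      have Wz: "W z \<noteq> 0" using ge Q1 by (auto simp: Q_def)
      have lnQ: "ln (Q k q) = ln (W q \<bullet> W q) + N * (dist q p)\<^sup>2 - real k * ln ((dist q p)\<^sup>2)"
        if "W q \<noteq> 0" "q \<noteq> p" for q
        using that unfolding Q_def by (simp add: ln_mult ln_div ln_realpow)
      have zp: "z \<noteq> p" using zd r0 by auto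
      have zX: "z \<in> X" "z \<in> cball p R" using zd R by (auto simp: dist_commute subset_iff)
      show False
      proof (rule no_local_max[OF zX(1) Wz _ ec(1)[OF zX(2)] ec(2)[OF zX(2)] N(1), of p "min (R - dist z p) (dist z p - r0)" k])
        show "z \<noteq> p" by (rule zp)
        show "0 < min (R - dist z p) (dist z p - r0)" using zd zR by simp
        fix q assume q: "dist q z < min (R - dist z p) (dist z p - r0)" "q \<in> X" "W q \<noteq> 0" "q \<noteq> p"
        have "dist q p \<le> dist q z + dist z p" "dist z p \<le> dist q z + dist q p"
          using dist_triangle[of q p z] dist_triangle[of z p q] by (simp_all add: dist_commute)
        with q(1) have "q \<in> A" unfolding A by auto
        then have "Q k q \<le> Q k z" by (rule z(2))
        moreover have "Q k q > 0" using q by (simp add: Q_def)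
        ultimately have "ln (Q k q) \<le> ln (Q k z)" by simp
        then show "ln (W q \<bullet> W q) + N * (dist q p)\<^sup>2 - real k * ln ((dist q p)\<^sup>2)
            \<le> ln (W z \<bullet> W z) + N * (dist z p)\<^sup>2 - real k * ln ((dist z p)\<^sup>2)"
          using lnQ[OF q(3,4)] lnQ[OF Wz zp] by linarith
      qed
    qed
    then have "Q k z = (W z \<bullet> W z) * exp (N * R\<^sup>2) / (R\<^sup>2) ^ k" by (simp add: Q_def)
    also have "\<dots> \<le> C * exp (N * R\<^sup>2) / (R\<^sup>2) ^ k"
      using C[of z] zd by (intro divide_right_mono mult_right_mono) (auto simp: dist_commute)
    finally have "Q k z \<le> C * exp (N * R\<^sup>2) / (R\<^sup>2) ^ k" .
    with ge show ?thesis by linarith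
  qed
  have "W z = 0" if z: "z \<in> ball p R" for z
  proof (rule ccontr)
    assume Wz: "W z \<noteq> 0"
    have d: "0 < dist z p" "dist z p < R" using z Wz Wp by (auto simp: dist_commute)
    define q where "q = (dist z p)\<^sup>2 / R\<^sup>2"
    have "(dist z p)\<^sup>2 < R\<^sup>2" using d by (intro power_strict_mono) auto
    then have q: "0 \<le> q" "q < 1" using R(1) by (simp_all add: q_def)
    have bound: "W z \<bullet> W z \<le> (C * exp (N * R\<^sup>2)) * q ^ k" for k
    proof -
      have "W z \<bullet> W z \<le> (W z \<bullet> W z) * exp (N * (dist z p)\<^sup>2)"
        using mult_left_mono[of 1 "exp (N * (dist z p)\<^sup>2)" "W z \<bullet> W z"] N by simp
      also have "\<dots> = Q k z * ((dist z p)\<^sup>2) ^ k" using d by (simp add: Q_def)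
      also have "\<dots> \<le> C * exp (N * R\<^sup>2) / (R\<^sup>2) ^ k * ((dist z p)\<^sup>2) ^ k"
        using main[OF z Wz, of k] by (intro mult_right_mono) auto
      also have "\<dots> = (C * exp (N * R\<^sup>2)) * q ^ k" by (simp add: q_def power_divide)
      finally show ?thesis .
    qed
    have "(\<lambda>k. (C * exp (N * R\<^sup>2)) * q ^ k) \<longlonglongrightarrow> (C * exp (N * R\<^sup>2)) * 0"
      by (intro tendsto_intros LIMSEQ_realpow_zero q)
    then have "W z \<bullet> W z \<le> (C * exp (N * R\<^sup>2)) * 0"
      by (rule LIMSEQ_le_const) (use bound in auto)
    moreover have "W z \<bullet> W z > 0" using Wz by simp
    ultimately show False by linarith
  qed
  with R(1) show ?thesis by blast
qed

text \<open>The equation expresses \<open>dbar W\<close> by \<open>W\<close> with smooth coefficients, so \<open>dbar W\<close> vanishes to the same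
  order as \<open>W\<close>, which is the hypothesis of the dichotomy between finite and infinite order.\<close>

theorem zeros_isolated_or_locally_everything:
  assumes p: "p \<in> X"
  shows "\<exists>r>0. (\<forall>z\<in>ball p r. W z = 0) \<or> (\<forall>z\<in>ball p r. z \<noteq> p \<longrightarrow> W z \<noteq> 0)"
proof -
  have "vanishes k X p (dbar W)" if k: "vanishes k X p W" for k
  proof (rule vanishes_cong[OF open_X p])
    show "(\<Sum>b\<in>Basis. (W q \<bullet> b) *\<^sub>R E q b) = dbar W q" if "q \<in> X" for q
      using equation[OF that] E_in_basis[OF that, of "W q"] by simp
    show "vanishes k X p (\<lambda>q. \<Sum>b\<in>Basis. (W q \<bullet> b) *\<^sub>R E q b)"
      by (intro vanishes_sum open_X p finite_Basis smooth_E
          vanishes_bilinear[OF open_X p bounded_bilinear_scaleR]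
          vanishes_bounded_linear[OF open_X p bounded_linear_inner_left k])
  qed
  from isolated_or_infinite_order_zero[OF open_X p smooth_W this] show ?thesis
  proof
    assume "\<forall>k. vanishes k X p W"
    then show ?thesis using strong_unique_continuation[OF p] by blast
  next
    assume "\<exists>r>0. \<forall>z. 0 < dist z p \<longrightarrow> dist z p < r \<longrightarrow> W z \<noteq> 0"
    then show ?thesis by (auto simp: dist_commute)
  qed
qed

end


section \<open>Conformal traces and the Chern connection\<close>

lemma bilinear_complex_expand:
  fixes B :: "complex \<Rightarrow> complex \<Rightarrow> 'b::real_vector"
  assumes "bilinear B"
  shows "B u v = (Re u * Re v) *\<^sub>R B 1 1 + (Re u * Im v) *\<^sub>R B 1 \<i>
    + (Im u * Re v) *\<^sub>R B \<i> 1 + (Im u * Im v) *\<^sub>R B \<i> \<i>"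
proof -
  have c: "w = Re w *\<^sub>R 1 + Im w *\<^sub>R \<i>" for w :: complex by (simp add: complex_eq_iff)
  have "B u v = B (Re u *\<^sub>R 1 + Im u *\<^sub>R \<i>) (Re v *\<^sub>R 1 + Im v *\<^sub>R \<i>)"
    using c[of u] c[of v] by simp
  then show ?thesis
    by (simp only: bilinear_ladd[OF assms] bilinear_radd[OF assms] bilinear_lmul[OF assms]
        bilinear_rmul[OF assms] scaleR_add_right scaleR_scaleR) (simp add: algebra_simps)
qed

lemma conformal_form:
  fixes h :: "complex \<Rightarrow> complex \<Rightarrow> real"
  assumes "bilinear h" "\<And>u v. h u v = h v u" "\<And>u v. h (J1 u) (J1 v) = h u v"
  shows "h u v = h 1 1 * (u \<bullet> v)" "h \<i> \<i> = h 1 1" "h 1 \<i> = 0" "h \<i> 1 = 0"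
proof -
  show 1: "h \<i> \<i> = h 1 1" using assms(3)[of 1 1] by (simp add: J1_def)
  have "h \<i> (- 1) = h 1 \<i>" using assms(3)[of 1 \<i>] by (simp add: J1_def)
  then have "- h \<i> 1 = h 1 \<i>" by (simp add: bilinear_rneg[OF assms(1)])
  then show 2: "h 1 \<i> = 0" using assms(2)[of 1 \<i>] by simp
  then show 3: "h \<i> 1 = 0" using assms(2)[of 1 \<i>] by simp
  show "h u v = h 1 1 * (u \<bullet> v)"
    unfolding bilinear_complex_expand[OF assms(1), of u v] 1 2 3 by (simp add: inner_complex_def algebra_simps)
qed

text \<open>A metric for which the rotation by a right angle is orthogonal is a multiple of the Euclidean one,
  so the vectors \<open>1\<close> and \<open>\<i>\<close> can be scaled to an orthonormal basis. The trace is defined with an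
  arbitrary orthonormal basis, and that its choice does not matter is part of the proof.\<close>

lemma metric_trace_zero_conformal:
  fixes h :: "complex \<Rightarrow> complex \<Rightarrow> real" and B :: "complex \<Rightarrow> complex \<Rightarrow> 'b::real_vector"
  assumes h: "bilinear h" "\<And>u v. h u v = h v u" "\<And>u v. h (J1 u) (J1 v) = h u v"
    and pos: "\<And>u. u \<noteq> 0 \<Longrightarrow> h u u > 0"
    and B: "bilinear B" and tr: "metric_trace h B = 0"
  shows "B 1 1 + B \<i> \<i> = 0"
proof -
  define l where "l = h 1 1"
  have l: "l > 0" using pos[of 1] by (simp add: l_def)
  have hl: "h u v = l * (u \<bullet> v)" for u v
    unfolding l_def by (rule conformal_form(1)[where h = h]) (use h in auto)
  define a where "a = 1 / sqrt l"
  have a: "a > 0" "l * (a * a) = 1" using l by (auto simp: a_def real_sqrt_mult_self)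
  have "complex_of_real a \<noteq> \<i> * complex_of_real a"
    using a by (auto simp: complex_eq_iff)
  then have "orthonormal_basis h {of_real a, \<i> * of_real a}"
    using a by (auto simp: orthonormal_basis_def hl inner_complex_def)
  then have "\<exists>E. orthonormal_basis h E" by blast
  define E where "E = (SOME E. orthonormal_basis h E)"
  have ob: "orthonormal_basis h E"
    unfolding E_def by (rule someI_ex) fact
  have E: "card E = 2" "\<And>u v. u \<in> E \<Longrightarrow> v \<in> E \<Longrightarrow> h u v = (if u = v then 1 else 0)"
    using ob by (auto simp: orthonormal_basis_def)
  obtain e1 e2 where e: "E = {e1, e2}" "e1 \<noteq> e2" using E(1) by (auto simp: card_2_iff)
  have o: "l * (e1 \<bullet> e1) = 1" "l * (e2 \<bullet> e2) = 1" "e1 \<bullet> e2 = 0"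
    using E(2)[of e1 e1] E(2)[of e2 e2] E(2)[of e1 e2] e l by (auto simp: hl)
  define x where "x = Re e1" define y where "y = Im e1"
  define x' where "x' = Re e2" define y' where "y' = Im e2"
  define m where "m = 1 / l"
  have m: "m > 0" using l by (simp add: m_def)
  have eq: "x * x + y * y = m" "x' * x' + y' * y' = m" "x * x' + y * y' = 0"
    using o l by (auto simp: inner_complex_def x_def y_def x'_def y'_def m_def field_simps)
  \<comment> \<open>Orthogonality forces the second basis vector to be the first one turned by a right angle,
    \<open>e2 = (\<delta> / m) \<i> e1\<close> with \<open>\<delta>\<^sup>2 = m\<^sup>2\<close>.\<close>
  define \<delta> where "\<delta> = x * y' - y * x'"
  have "\<delta> * \<delta> = (x * x + y * y) * (x' * x' + y' * y') - (x * x' + y * y') * (x * x' + y * y')"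
    by (simp add: \<delta>_def algebra_simps)
  then have \<delta>: "\<delta> * \<delta> = m * m" using eq by simp
  have "(x * x + y * y) * x' = x * (x * x' + y * y') - y * \<delta>"
       "(x * x + y * y) * y' = y * (x * x' + y * y') + x * \<delta>"
    by (simp_all add: \<delta>_def algebra_simps)
  then have turn: "m * x' = - (y * \<delta>)" "m * y' = x * \<delta>" using eq by simp_all
  have "(m * x') * (m * x') = (y * y) * (\<delta> * \<delta>)" "(m * y') * (m * y') = (x * x) * (\<delta> * \<delta>)"
       "(m * x') * (m * y') = - (x * y) * (\<delta> * \<delta>)"
    by (simp_all add: turn algebra_simps)
  then have "(m * m) * (x' * x') = (m * m) * (y * y)" "(m * m) * (y' * y') = (m * m) * (x * x)"
       "(m * m) * (x * y + x' * y') = 0"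
    by (simp_all add: \<delta> algebra_simps)
  then have "x' * x' = y * y" "y' * y' = x * x" "x * y + x' * y' = 0"
    using m by simp_all
  with eq(1) have eq': "x * x + x' * x' = m" "y * y + y' * y' = m" "x * y + x' * y' = 0" by simp_all
  have "0 = B e1 e1 + B e2 e2"
    using tr e by (simp add: metric_trace_def E_def[symmetric])
  also have "\<dots> = (x * x + x' * x') *\<^sub>R B 1 1 + (x * y + x' * y') *\<^sub>R B 1 \<i>
      + (x * y + x' * y') *\<^sub>R B \<i> 1 + (y * y + y' * y') *\<^sub>R B \<i> \<i>"
    unfolding bilinear_complex_expand[OF B, of e1 e1] bilinear_complex_expand[OF B, of e2 e2]
      x_def[symmetric] y_def[symmetric] x'_def[symmetric] y'_def[symmetric]
    by (simp add: algebra_simps)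
  also have "\<dots> = m *\<^sub>R (B 1 1 + B \<i> \<i>)" by (simp add: eq' scaleR_add_right)
  finally show ?thesis using m by simp
qed

lemma cov_deriv_const: "cov_deriv G p u (\<lambda>_. v) = G p u v"
  by (simp add: cov_deriv_def)

text \<open>Coordinates that are isothermal for \<open>h\<close> are harmonic functions. The computation compares the
  derivatives of the constant relations \<open>h 1 1 = h \<i> \<i>\<close> and \<open>h 1 \<i> = 0\<close> by the Leibniz rule and uses
  the symmetry of the Christoffel symbols.\<close>

lemma levi_civita_conformal:
  fixes S :: "('s::t2_space, complex) chart set"
  assumes hm: "hermitian_metric J1 S h" and lc: "levi_civita_connection S h D"
    and c: "c \<in> S" "is_chart c" and p: "p \<in> chart_codom c"
  shows "D c p 1 1 + D c p \<i> \<i> = 0"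
proof -
  let ?X = "chart_codom c" and ?D = "D c p"
  have X: "open ?X" using c by (simp add: is_chart_def)
  have h: "bilinear (h c q)" "h c q u v = h c q v u" "h c q (J1 u) (J1 v) = h c q u v"
      "u \<noteq> 0 \<Longrightarrow> h c q u u > 0" if "q \<in> ?X" for q u v
    using hm c that unfolding hermitian_metric_def riemannian_metric_def by blast+
  note conf = conformal_form[of "h c q" for q, OF h(1-3)]
  have par: "dir_deriv u (\<lambda>q. h c q v w) p = h c p (?D u v) w + h c p v (?D u w)" for u v w
    using lc c p smooth_on_const[of ?X]
    unfolding levi_civita_connection_def metric_parallel_def by (fastforce simp: cov_deriv_const)
  have tor: "?D u v = ?D v u" for u v
    using lc c p unfolding levi_civita_connection_def torsion_def by (auto simp: cov_deriv_const)
  have d: "dir_deriv u (\<lambda>q. h c q \<i> \<i>) p = dir_deriv u (\<lambda>q. h c q 1 1) p" for u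
    using differential_cong[OF X p, of "\<lambda>q. h c q \<i> \<i>" "\<lambda>q. h c q 1 1"] conf(2) by simp
  have d0: "dir_deriv u (\<lambda>q. h c q 1 \<i>) p = 0" for u
    using differential_cong[OF X p, of "\<lambda>q. h c q 1 \<i>" "\<lambda>q. 0"] conf(3) by simp
  have sym: "h c p u v = h c p v u" for u v using h(2)[OF p] .
  have add: "h c p (u + v) w = h c p u w + h c p v w" for u v w by (rule bilinear_ladd[OF h(1)[OF p]])
  have "2 * h c p (?D 1 1) 1 = 2 * h c p (?D 1 \<i>) \<i>"
    using par[where u = 1 and v = 1 and w = 1] par[where u = 1 and v = \<i> and w = \<i>] d[of 1] sym[of 1 "?D 1 1"] sym[of \<i> "?D 1 \<i>"] by linarith
  moreover have "h c p (?D \<i> 1) \<i> + h c p 1 (?D \<i> \<i>) = 0" using par[where u = \<i> and v = 1 and w = \<i>] d0[of \<i>] by linarith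
  ultimately have 1: "h c p (?D 1 1 + ?D \<i> \<i>) 1 = 0"
    using sym[of 1 "?D \<i> \<i>"] unfolding add tor[of 1 \<i>] by linarith
  have "2 * h c p (?D \<i> \<i>) \<i> = 2 * h c p (?D \<i> 1) 1"
    using par[where u = \<i> and v = 1 and w = 1] par[where u = \<i> and v = \<i> and w = \<i>] d[of \<i>] sym[of 1 "?D \<i> 1"] sym[of \<i> "?D \<i> \<i>"] by linarith
  moreover have "h c p (?D 1 1) \<i> + h c p 1 (?D 1 \<i>) = 0" using par[where u = 1 and v = 1 and w = \<i>] d0[of 1] by linarith
  ultimately have 2: "h c p (?D 1 1 + ?D \<i> \<i>) \<i> = 0"
    using sym[of 1 "?D \<i> 1"] unfolding add tor[of 1 \<i>] by linarith
  have l: "h c p 1 1 > 0" using h(4)[OF p] by simp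
  have "h c p 1 1 * ((?D 1 1 + ?D \<i> \<i>) \<bullet> 1) = 0" "h c p 1 1 * ((?D 1 1 + ?D \<i> \<i>) \<bullet> \<i>) = 0"
    unfolding conf(1)[OF p p p, symmetric] by (rule 1, rule 2)
  then have "(?D 1 1 + ?D \<i> \<i>) \<bullet> 1 = 0" "(?D 1 1 + ?D \<i> \<i>) \<bullet> \<i> = 0" using l by auto
  then have "Re (?D 1 1 + ?D \<i> \<i>) = 0" "Im (?D 1 1 + ?D \<i> \<i>) = 0"
    by (simp_all add: inner_complex_def)
  then show ?thesis by (simp add: complex_eq_iff)
qed

lemma J2_J2: "J2 (J2 v) = - v"
  by (simp add: J2_def vec_eq_iff)

lemma linear_J2: "linear J2"
  by (rule linearI) (simp_all add: J2_def vec_eq_iff algebra_simps)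

interpretation J2: orthogonal_complex_structure J2
proof (rule orthogonal_complex_structure.intro)
  show "J2 u \<bullet> J2 v = u \<bullet> v" for u v
    by (simp add: J2_def inner_vec_def inner_complex_def add.commute)
qed (simp_all add: linear_J2 J2_J2)

lemma (in orthogonal_complex_structure) conjugate_structure:
  "orthogonal_complex_structure (\<lambda>v. - J v)"
proof (rule orthogonal_complex_structure.intro)
  show "linear (\<lambda>v. - J v)" by (intro linear_compose_neg linear_J)
qed (simp_all add: J_simps J_J J_isometry)

text \<open>Linearity over \<open>J\<close> in the second argument is \<open>\<nabla>J = 0\<close> for constant fields. The failure \<open>A\<close> of
  linearity in the first argument is antilinear there and linear in the second argument; the vanishing
  of the \<open>(1,1)\<close>-part of the torsion says that \<open>A\<close> is symmetric, so it is both linear and antilinear,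
  hence zero.\<close>

lemma chern_connection_complex_bilinear:
  assumes ch: "chern_connection M g G" and d: "d \<in> M" and p: "p \<in> chart_codom d"
  shows "G d p u (J2 v) = J2 (G d p u v)" "G d p (J2 u) v = J2 (G d p u v)"
proof -
  let ?G = "G d p"
  have bil: "bilinear ?G" using ch d p unfolding chern_connection_def affine_connection_def by blast
  have J: "?G u (J2 v) = J2 (?G u v)" for u v
    using ch d p smooth_on_const[of "chart_codom d"]
    unfolding chern_connection_def complex_structure_parallel_def by (fastforce simp: cov_deriv_const)
  then show "?G u (J2 v) = J2 (?G u v)" .
  define A where "A = (\<lambda>u v. ?G u v + J2 (?G (J2 u) v))"
  have "part_1_1 J2 (torsion (G d) p) u v = 0" for u v
    using ch d p unfolding chern_connection_def by blast
  then have tor: "?G u v - ?G v u + (?G (J2 u) (J2 v) - ?G (J2 v) (J2 u)) = 0" for u v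
    by (simp add: part_1_1_def torsion_def cov_deriv_const)
  have sym: "A u v = A v u" for u v
    using tor[of u v] by (simp add: A_def J algebra_simps)
  have left: "A (J2 u) v = - J2 (A u v)" for u v
    by (simp add: A_def J2_J2 J2.J_simps bilinear_lneg[OF bil])
  have right: "A u (J2 v) = J2 (A u v)" for u v
    by (simp add: A_def J J2.J_simps)
  have "J2 (A u v) = - J2 (A u v)" using left[of u v] right[of v u] sym[of "J2 u" v] sym[of v u] by simp
  then have "J2 (A u v) + J2 (A u v) = 0" by (simp add: eq_neg_iff_add_eq_0)
  then have "J2 (A u v) = 0" by (simp flip: scaleR_2)
  then have "J2 (J2 (A u v)) = 0" by (simp add: J2.J_simps)
  then have "A u v = 0" by (simp only: J2_J2 neg_equal_0_iff_equal)
  then have "?G u v + J2 (?G (J2 u) v) = 0" by (simp only: A_def)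
  then have "J2 (?G u v + J2 (?G (J2 u) v)) = 0" by (simp add: J2.J_simps)
  then have "J2 (?G u v) + J2 (J2 (?G (J2 u) v)) = 0" by (simp only: J2.J_simps)
  then show "?G (J2 u) v = J2 (?G u v)" by (simp add: J2_J2)
qed

lemma smooth_on_contraction:
  fixes G :: "'h::euclidean_space \<Rightarrow> 'h \<Rightarrow> 'h \<Rightarrow> 'h"
  assumes X: "open X" and Y: "open Y" and F: "smooth_on X F" "F ` X \<subseteq> Y"
    and G: "\<And>u v. smooth_on Y (\<lambda>p. G p u v)" "\<And>p v. p \<in> Y \<Longrightarrow> linear (\<lambda>u. G p u v)"
    and a: "smooth_on X a"
  shows "smooth_on X (\<lambda>z. G (F z) (a z) v)"
proof (rule smooth_on_cong[OF X])
  show "smooth_on X (\<lambda>z. \<Sum>b\<in>Basis. (a z \<bullet> b) *\<^sub>R G (F z) b v)"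
    by (intro smooth_on_sum X finite_Basis smooth_on_bilinear[OF X bounded_bilinear_scaleR]
        smooth_on_bounded_linear[OF X bounded_linear_inner_left a] smooth_on_compose[OF X Y F(2,1) G(1)])
  show "(\<Sum>b\<in>Basis. (a z \<bullet> b) *\<^sub>R G (F z) b v) = G (F z) (a z) v" if "z \<in> X" for z
  proof -
    have l: "linear (\<lambda>u. G (F z) u v)" using G(2) F(2) that by blast
    have "G (F z) (a z) v = G (F z) (\<Sum>b\<in>Basis. (a z \<bullet> b) *\<^sub>R b) v" by (simp add: euclidean_representation)
    then show ?thesis by (simp add: linear_sum[OF l] linear_scale[OF l])
  qed
qed

context orthogonal_complex_structure
begin

text \<open>With \<open>a = del F\<close> and \<open>b = dbar F\<close>, complex bilinearity and \<open>F\<^sub>x = (a + b) / 2\<close>, \<open>F\<^sub>y = J (a - b) / 2\<close> turn the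
  quadratic term into \<open>(G(a + b, a + b) - G(a - b, a - b)) / 4\<close>, in which \<open>G(a, a)\<close> cancels. What is left
  is complex linear in \<open>b\<close>, and the Laplacian is \<open>del\<close> of \<open>b\<close>, which is \<open>dbar\<close> for the structure \<open>- J\<close>.\<close>

lemma dbar_zeros_of_quadratic_laplace_equation:
  assumes X: "open X" and Y: "open Y" and F: "smooth_on X F" "F ` X \<subseteq> Y"
    and smooth_G: "\<And>u v. smooth_on Y (\<lambda>q. G q u v)"
    and bilinear_G: "\<And>q. q \<in> Y \<Longrightarrow> bilinear (G q)"
    and GJ: "\<And>q u v. q \<in> Y \<Longrightarrow> G q (J u) v = J (G q u v)" "\<And>q u v. q \<in> Y \<Longrightarrow> G q u (J v) = J (G q u v)"
    and laplace: "\<And>z. z \<in> X \<Longrightarrow> dir_deriv 1 (dir_deriv 1 F) z + dir_deriv \<i> (dir_deriv \<i> F) z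
        + G (F z) (dir_deriv 1 F z) (dir_deriv 1 F z) + G (F z) (dir_deriv \<i> F z) (dir_deriv \<i> F z) = 0"
    and p: "p \<in> X"
  shows "\<exists>r>0. (\<forall>z\<in>ball p r. dbar F z = 0) \<or> (\<forall>z\<in>ball p r. z \<noteq> p \<longrightarrow> dbar F z \<noteq> 0)"
proof -
  define E where "E = (\<lambda>z v. (-1/2) *\<^sub>R (G (F z) (del F z) v + G (F z) v (del F z)))"
  interpret conj: orthogonal_complex_structure "\<lambda>v. - J v" by (rule conjugate_structure)
  interpret cauchy_riemann_system "\<lambda>v. - J v" X E "dbar F"
  proof (intro cauchy_riemann_system.intro cauchy_riemann_system_axioms.intro conjugate_structure)
    show "open X" by (rule X)
    show "smooth_on X (dbar F)" by (rule smooth_on_dbar[OF X p F(1)])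
    fix z assume z: "z \<in> X"
    have FY: "F z \<in> Y" using F(2) z by blast
    note bil = bilinear_G[OF FY]
    show "linear (E z)"
      unfolding E_def
      by (rule linearI) (simp_all add: bilinear_ladd[OF bil] bilinear_radd[OF bil] bilinear_lmul[OF bil]
          bilinear_rmul[OF bil] algebra_simps)
    show "E z (- J v) = - J (E z v)" for v
      by (simp add: E_def GJ[OF FY] bilinear_lneg[OF bil] bilinear_rneg[OF bil] J_simps
          scaleR_add_right scaleR_diff_right)
    let ?a = "del F z" and ?b = "dbar F z"
    have "G (F z) (dir_deriv 1 F z) (dir_deriv 1 F z) = (1/4) *\<^sub>R G (F z) (?a + ?b) (?a + ?b)"
      unfolding dir_derivs_from_del_dbar by (simp add: bilinear_lmul[OF bil] bilinear_rmul[OF bil])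
    moreover have JJ: "G (F z) (J v) (J v) = - G (F z) v v" for v by (simp add: GJ[OF FY] J_J)
    have "G (F z) (dir_deriv \<i> F z) (dir_deriv \<i> F z) = - (1/4) *\<^sub>R G (F z) (?a - ?b) (?a - ?b)"
      unfolding dir_derivs_from_del_dbar by (simp add: bilinear_lmul[OF bil] bilinear_rmul[OF bil] JJ)
    ultimately have "G (F z) (dir_deriv 1 F z) (dir_deriv 1 F z) + G (F z) (dir_deriv \<i> F z) (dir_deriv \<i> F z)
        = (1/4) *\<^sub>R (G (F z) (?a + ?b) (?a + ?b) - G (F z) (?a - ?b) (?a - ?b))"
      by (simp add: algebra_simps)
    also have "G (F z) (?a + ?b) (?a + ?b) - G (F z) (?a - ?b) (?a - ?b)
        = 2 *\<^sub>R (G (F z) ?a ?b + G (F z) ?b ?a)"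
      by (simp add: bilinear_ladd[OF bil] bilinear_radd[OF bil] bilinear_lsub[OF bil] bilinear_rsub[OF bil] scaleR_2)
    finally have quad: "G (F z) (dir_deriv 1 F z) (dir_deriv 1 F z) + G (F z) (dir_deriv \<i> F z) (dir_deriv \<i> F z)
        = - E z ?b"
      by (simp add: E_def)
    have "conj.dbar (dbar F) z = del (dbar F) z"
      by (simp add: conj.dbar_def del_def)
    also have "\<dots> = dir_deriv 1 (dir_deriv 1 F) z + dir_deriv \<i> (dir_deriv \<i> F) z"
      by (rule laplacian_factors[OF X F(1) z])
    also have "\<dots> = E z ?b"
    proof -
      have "(dir_deriv 1 (dir_deriv 1 F) z + dir_deriv \<i> (dir_deriv \<i> F) z) + - E z ?b = 0"
        using laplace[OF z] by (simp only: add.assoc quad)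
      then show ?thesis by (simp only: add_uminus_conv_diff right_minus_eq)
    qed
    finally show "conj.dbar (dbar F) z = E z ?b" .
  next
    fix v
    have "smooth_on X (\<lambda>z. G (F z) (del F z) v)"
      by (rule smooth_on_contraction[OF X Y F smooth_G _ smooth_on_del[OF X p F(1)]])
         (use bilinear_G in \<open>simp add: bilinear_def\<close>)
    moreover have "smooth_on X (\<lambda>z. G (F z) v (del F z))"
      by (rule smooth_on_contraction[OF X Y F, of "\<lambda>q u v. G q v u", OF smooth_G _ smooth_on_del[OF X p F(1)]])
         (use bilinear_G in \<open>simp add: bilinear_def\<close>)
    ultimately show "smooth_on X (\<lambda>z. E z v)"
      unfolding E_def
      by (intro smooth_on_bounded_linear[OF X bounded_linear_scaleR_right] smooth_on_add X)
  qed
  show ?thesis by (rule zeros_isolated_or_locally_everything[OF p])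
qed

end


section \<open>Chern minimal maps in charts\<close>

lemma chart_simps:
  assumes "is_chart c"
  shows "open (chart_dom c)" "open (chart_codom c)" "continuous_on (chart_dom c) (chart_map c)"
    "continuous_on (chart_codom c) (chart_inv c)"
    "x \<in> chart_dom c \<Longrightarrow> chart_inv c (chart_map c x) = x"
    "x \<in> chart_dom c \<Longrightarrow> chart_map c x \<in> chart_codom c"
    "p \<in> chart_codom c \<Longrightarrow> chart_map c (chart_inv c p) = p"
    "p \<in> chart_codom c \<Longrightarrow> chart_inv c p \<in> chart_dom c"
  using assms unfolding is_chart_def homeomorphism_def by auto

lemma open_rep_dom:
  assumes "is_chart c" "is_chart d" "continuous_on UNIV f"
  shows "open (rep_dom c d f)"
proof -
  have "continuous_on (chart_codom c) (\<lambda>p. f (chart_inv c p))"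
    using continuous_on_compose2[OF assms(3) chart_simps(4)[OF assms(1)]] by simp
  then have "open (chart_codom c \<inter> (\<lambda>p. f (chart_inv c p)) -` chart_dom d)"
    by (rule continuous_open_preimage) (rule chart_simps[OF assms(1)], rule chart_simps[OF assms(2)])
  then show ?thesis by (simp add: rep_dom_def vimage_def Int_def)
qed

lemma local_rep_in_codom: "local_rep c d f ` rep_dom c d f \<subseteq> chart_codom d"
  by (auto simp: local_rep_def rep_dom_def chart_codom_def)

lemma map_in_rep_dom:
  assumes "is_chart c"
  shows "x \<in> chart_dom c \<Longrightarrow> chart_map c x \<in> rep_dom c d f \<longleftrightarrow> f x \<in> chart_dom d"
  by (simp add: rep_dom_def chart_simps[OF assms])

definition complex_linear_wrt :: "(complex^2 \<Rightarrow> complex^2) \<Rightarrow> (complex \<Rightarrow> complex^2) \<Rightarrow> bool" where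
  "complex_linear_wrt K L \<longleftrightarrow> (\<forall>v. L (J1 v) = K (L v))"

text \<open>By the chain rule, since changes of coordinates have complex linear differentials; linearity with
  respect to \<open>J2\<close> and with respect to \<open>- J2\<close> are the same for a real linear map between complex planes.\<close>

lemma complex_linear_wrt_local_rep_change:
  assumes atlas: "complex_atlas J1 S" "complex_atlas J2 M" and sm: "smooth_map S M f"
    and K: "K = J2 \<or> K = (\<lambda>v. - J2 v)"
    and c: "c \<in> S" "x \<in> chart_dom c" and d: "d \<in> M" "f x \<in> chart_dom d"
    and c': "c' \<in> S" "x \<in> chart_dom c'" and d': "d' \<in> M" "f x \<in> chart_dom d'"
    and it: "complex_linear_wrt K (differential (local_rep c d f) (chart_map c x))"
  shows "complex_linear_wrt K (differential (local_rep c' d' f) (chart_map c' x))"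
proof -
  have ch: "is_chart c" "is_chart c'" "is_chart d" "is_chart d'"
    using atlas c d c' d' by (auto simp: complex_atlas_def smooth_atlas_def)
  have cont: "continuous_on UNIV f" using sm by (simp add: smooth_map_def)
  define \<phi> where "\<phi> = local_rep c' c id"
  define \<psi> where "\<psi> = local_rep d d' id"
  define F where "F = local_rep c d f"
  let ?p' = "chart_map c' x"
  have pt: "\<phi> ?p' = chart_map c x" "F (chart_map c x) = chart_map d (f x)"
    using ch c c' by (simp_all add: \<phi>_def F_def local_rep_def chart_simps)
  have dom: "?p' \<in> rep_dom c' c id" "chart_map c x \<in> rep_dom c d f"
      "chart_map d (f x) \<in> rep_dom d d' id"
    using ch c d c' d' by (simp_all add: map_in_rep_dom)
  have "smooth_on (rep_dom c' c id) \<phi>" "smooth_on (rep_dom d d' id) \<psi>" "smooth_on (rep_dom c d f) F"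
    using atlas sm c d c' d' unfolding complex_atlas_def smooth_atlas_def smooth_map_def \<phi>_def \<psi>_def F_def
    by blast+
  note der = smooth_on_has_derivative[OF this(1) dom(1)] smooth_on_has_derivative[OF this(2) dom(3)]
    smooth_on_has_derivative[OF this(3) dom(2)]
  have "((\<psi> \<circ> (F \<circ> \<phi>)) has_derivative
      differential \<psi> (chart_map d (f x)) \<circ> (differential F (chart_map c x) \<circ> differential \<phi> ?p')) (at ?p')"
    by (intro diff_chain_at) (use der pt in auto)
  moreover have "open (rep_dom c' c id \<inter> rep_dom c' d f)"
    using open_rep_dom[OF ch(2,1), of id] open_rep_dom[OF ch(2,3) cont] by (simp add: id_def open_Int)
  moreover have "?p' \<in> rep_dom c' c id \<inter> rep_dom c' d f"
    using ch c c' d by (simp add: map_in_rep_dom)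
  moreover have "(\<psi> \<circ> (F \<circ> \<phi>)) q = local_rep c' d' f q" if "q \<in> rep_dom c' c id \<inter> rep_dom c' d f" for q
    using that ch by (auto simp: \<psi>_def F_def \<phi>_def local_rep_def rep_dom_def chart_simps)
  ultimately have "(local_rep c' d' f has_derivative
      differential \<psi> (chart_map d (f x)) \<circ> (differential F (chart_map c x) \<circ> differential \<phi> ?p')) (at ?p')"
    by (rule has_derivative_transform_within_open) auto
  then have D: "differential (local_rep c' d' f) ?p' v =
      differential \<psi> (chart_map d (f x)) (differential F (chart_map c x) (differential \<phi> ?p' v))" for v
    using differential_eqI by fastforce
  have 1: "differential \<phi> ?p' (J1 v) = J1 (differential \<phi> ?p' v)" for v
    using atlas(1) c c' dom(1) unfolding complex_atlas_def \<phi>_def by blast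
  have 2: "differential F (chart_map c x) (J1 v) = K (differential F (chart_map c x) v)" for v
    using it unfolding complex_linear_wrt_def F_def by blast
  have J2: "differential \<psi> (chart_map d (f x)) (J2 v) = J2 (differential \<psi> (chart_map d (f x)) v)" for v
    using atlas(2) d d' dom(3) unfolding complex_atlas_def \<psi>_def by blast
  have "linear (differential \<psi> (chart_map d (f x)))"
    using der(2) has_derivative_linear by blast
  then have 3: "differential \<psi> (chart_map d (f x)) (K v) = K (differential \<psi> (chart_map d (f x)) v)" for v
    using K by (auto simp: J2 linear_neg)
  show ?thesis by (simp add: complex_linear_wrt_def D 1 2 3)
qed

text \<open>The common form of complex points (\<open>K = J2\<close>) and anticomplex points (\<open>K = - J2\<close>).\<close>

definition complex_linear_point ::
  "(complex^2 \<Rightarrow> complex^2) \<Rightarrow> ('s::t2_space, complex) chart set \<Rightarrow>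
   ('m::{t2_space,second_countable_topology}, complex^2) chart set \<Rightarrow> ('s \<Rightarrow> 'm) \<Rightarrow> 's \<Rightarrow> bool" where
  "complex_linear_point K S M f x \<longleftrightarrow> (\<forall>c\<in>S. \<forall>d\<in>M. x \<in> chart_dom c \<longrightarrow> f x \<in> chart_dom d \<longrightarrow>
     complex_linear_wrt K (differential (local_rep c d f) (chart_map c x)))"

lemma complex_point_iff: "complex_point S M f x \<longleftrightarrow> complex_linear_point J2 S M f x"
  and anticomplex_point_iff: "anticomplex_point S M f x \<longleftrightarrow> complex_linear_point (\<lambda>v. - J2 v) S M f x"
  unfolding complex_point_def anticomplex_point_def complex_linear_point_def complex_linear_wrt_def
  by (simp_all add: fun_eq_iff)

lemma complex_linear_point_in_charts:
  assumes "complex_atlas J1 S" "complex_atlas J2 M" "smooth_map S M f" "K = J2 \<or> K = (\<lambda>v. - J2 v)"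
    and "c \<in> S" "x \<in> chart_dom c" "d \<in> M" "f x \<in> chart_dom d"
  shows "complex_linear_point K S M f x \<longleftrightarrow> complex_linear_wrt K (differential (local_rep c d f) (chart_map c x))"
  unfolding complex_linear_point_def using complex_linear_wrt_local_rep_change[OF assms] assms(5-8) by blast

lemma (in orthogonal_complex_structure) dbar_eq_0_iff:
  assumes "F differentiable (at p)"
  shows "dbar F p = 0 \<longleftrightarrow> (\<forall>v. differential F p (J1 v) = J (differential F p v))"
proof
  assume "dbar F p = 0"
  then have "differential F p 1 = - J (differential F p \<i>)"
    unfolding dbar_def by (simp add: eq_neg_iff_add_eq_0)
  then have "differential F p (J1 v) = J (differential F p v)" for v
    unfolding differential_complex[OF assms, of "J1 v"] differential_complex[OF assms, of v]
    by (simp add: J1_def J_simps J_J)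
  then show "\<forall>v. differential F p (J1 v) = J (differential F p v)" ..
next
  assume "\<forall>v. differential F p (J1 v) = J (differential F p v)"
  from spec[OF this, of 1] have "differential F p \<i> = J (differential F p 1)" by (simp add: J1_def)
  then show "dbar F p = 0" by (simp add: dbar_def J_J)
qed

text \<open>The second fundamental form \<open>B\<close> is bilinear; in its second argument this rests on the symmetry of
  second derivatives. In the trace the Levi-Civita part drops out by \<open>levi_civita_conformal\<close>.\<close>

lemma chern_minimal_equation:
  assumes atlas: "complex_atlas J1 S" "complex_atlas J2 M" and sm: "smooth_map S M f"
    and hm: "hermitian_metric J1 S ds2" and lc: "levi_civita_connection S ds2 D"
    and aff: "affine_connection M G" and cm: "chern_minimal S M G ds2 D f"
    and c: "c \<in> S" and d: "d \<in> M" and z: "z \<in> rep_dom c d f"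
  defines "F \<equiv> local_rep c d f"
  shows "dir_deriv 1 (dir_deriv 1 F) z + dir_deriv \<i> (dir_deriv \<i> F) z
    + G d (F z) (dir_deriv 1 F z) (dir_deriv 1 F z) + G d (F z) (dir_deriv \<i> F z) (dir_deriv \<i> F z) = 0"
proof -
  have ch: "is_chart c" "is_chart d" using atlas c d by (auto simp: complex_atlas_def smooth_atlas_def)
  have X: "open (rep_dom c d f)" using sm open_rep_dom[OF ch] unfolding smooth_map_def by blast
  have F: "smooth_on (rep_dom c d f) F" using sm c d unfolding smooth_map_def F_def by blast
  have zc: "z \<in> chart_codom c" using z by (simp add: rep_dom_def)
  have "F z \<in> chart_codom d" using subsetD[OF local_rep_in_codom imageI[OF z]] by (simp add: F_def)
  then have bilG: "bilinear (G d (F z))" using aff d unfolding affine_connection_def by blast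
  have bilD: "bilinear (D c z)" using lc c zc unfolding levi_civita_connection_def affine_connection_def by blast
  have h: "bilinear (ds2 c z)" "\<And>u v. ds2 c z u v = ds2 c z v u"
      "\<And>u v. ds2 c z (J1 u) (J1 v) = ds2 c z u v" "\<And>u. u \<noteq> 0 \<Longrightarrow> ds2 c z u u > 0"
    using hm c zc unfolding hermitian_metric_def riemannian_metric_def by blast+
  have linF: "linear (differential F z)"
    by (rule linear_frechet_derivative[OF smooth_onD_differentiable[OF F z]])
  have lin2: "linear (differential (dir_deriv v F) z)" for v
    by (rule linear_frechet_derivative[OF smooth_onD_differentiable[OF smooth_on_dir_deriv[OF F] z]])
  define B where "B = nabla_df (D c) (G d) F z"
  have B: "B u v = dir_deriv u (dir_deriv v F) z + G d (F z) (differential F z u) (differential F z v)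
      - differential F z (D c z u v)" for u v
    by (simp add: B_def nabla_df_def pullback_cov_deriv_def cov_deriv_const)
  have B': "B u v = dir_deriv v (dir_deriv u F) z + G d (F z) (differential F z u) (differential F z v)
      - differential F z (D c z u v)" for u v
    unfolding B by (simp add: dir_deriv_commute[OF X F z, of u v])
  note rules = linear_add[OF linF] linear_scale[OF linF] linear_add[OF lin2] linear_scale[OF lin2]
    bilinear_ladd[OF bilG] bilinear_radd[OF bilG] bilinear_lmul[OF bilG] bilinear_rmul[OF bilG]
    bilinear_ladd[OF bilD] bilinear_radd[OF bilD] bilinear_lmul[OF bilD] bilinear_rmul[OF bilD]
  have bilB: "bilinear B"
    unfolding bilinear_def
  proof (intro conjI allI)
    show "linear (B u)" for u
      by (rule linearI; unfold B'; simp only: rules) (simp_all add: algebra_simps)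
    show "linear (\<lambda>u. B u v)" for v
      by (rule linearI; unfold B; simp only: rules) (simp_all add: algebra_simps)
  qed
  have trB: "metric_trace (ds2 c z) B = 0"
    using cm c d z unfolding chern_minimal_def B_def F_def by blast
  have "B 1 1 + B \<i> \<i> = 0"
    by (rule metric_trace_zero_conformal[where h = "ds2 c z"]) (fact h bilB trB)+
  moreover have "differential F z (D c z 1 1) + differential F z (D c z \<i> \<i>) = 0"
    using levi_civita_conformal[OF hm lc c ch(1) zc] linear_0[OF linF] by (simp flip: linear_add[OF linF])
  ultimately show ?thesis unfolding B by (simp add: algebra_simps)
qed

section \<open>Discreteness\<close>

text \<open>The interior of \<open>Z\<close> is also closed: a point outside it has a neighbourhood that meets \<open>Z\<close> at most in
  that point, and so contains no interior point of \<open>Z\<close>.\<close>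

lemma discrete_or_everything:
  fixes Z :: "'s::t2_space set"
  assumes conn: "connected (UNIV :: 's set)"
    and local: "\<And>x. \<exists>U. open U \<and> x \<in> U \<and> (U \<subseteq> Z \<or> U \<inter> Z \<subseteq> {x})"
  shows "Z = UNIV \<or> discrete Z"
proof -
  have "\<exists>T. open T \<and> x \<in> T \<and> T \<subseteq> - interior Z" if x: "x \<in> - interior Z" for x
  proof -
    obtain U where U: "open U" "x \<in> U" "U \<subseteq> Z \<or> U \<inter> Z \<subseteq> {x}" using local by blast
    have "\<not> U \<subseteq> Z" using x U interior_maximal by blast
    then have UZ: "U \<inter> Z \<subseteq> {x}" using U by blast
    have "y \<notin> interior Z" if "y \<in> U" for y
      using UZ x that interior_subset[of Z] by blast
    then show ?thesis using U by blast
  qed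
  then have "open (- interior Z)" by (subst open_subopen) blast
  then have "closed (interior Z)" by (simp add: closed_def)
  then have "interior Z = {} \<or> interior Z = UNIV"
    using conn connected_clopen[of "UNIV :: 's set"] by (simp add: open_interior)
  then show ?thesis
  proof
    assume e: "interior Z = {}"
    have "discrete Z"
    proof (rule discreteI)
      fix x assume x: "x \<in> Z"
      obtain U where U: "open U" "x \<in> U" "U \<subseteq> Z \<or> U \<inter> Z \<subseteq> {x}" using local by blast
      have "\<not> U \<subseteq> Z" using e U interior_maximal by blast
      then have "U \<inter> Z = {x}" using U x by blast
      then show "x isolated_in Z" using U x unfolding isolated_in_def by blast
    qed
    then show ?thesis ..
  qed (use interior_subset[of Z] in blast)
qed

lemma complex_linear_points_discrete_or_everything:
  fixes S :: "('s::t2_space, complex) chart set"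
    and M :: "('m::{t2_space,second_countable_topology}, complex^2) chart set"
  assumes S: "riemann_surface S" and M: "hermitian_surface M g" and ch: "chern_connection M g G"
    and f: "conformal_isometric_immersion S M g f ds2" and lc: "levi_civita_connection S ds2 D"
    and cm: "chern_minimal S M G ds2 D f"
    and K: "K = J2 \<or> K = (\<lambda>v. - J2 v)"
  shows "(\<forall>x. complex_linear_point K S M f x) \<or> discrete {x. complex_linear_point K S M f x}"
proof -
  interpret K: orthogonal_complex_structure K
    using K J2.orthogonal_complex_structure_axioms J2.conjugate_structure by auto
  have atlas: "complex_atlas J1 S" "complex_atlas J2 M"
    using S M by (auto simp: riemann_surface_def hermitian_surface_def complex_surface_def)
  have sm: "smooth_map S M f" and hm: "hermitian_metric J1 S ds2"
    using f by (auto simp: conformal_isometric_immersion_def immersion_def)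
  have cont: "continuous_on UNIV f" using sm by (simp add: smooth_map_def)
  have aff: "affine_connection M G" using ch by (simp add: chern_connection_def)
  have "\<exists>U. open U \<and> x \<in> U \<and> (U \<subseteq> {x. complex_linear_point K S M f x} \<or> U \<inter> {x. complex_linear_point K S M f x} \<subseteq> {x})" for x
  proof -
    have "x \<in> (\<Union>c\<in>S. chart_dom c)" "f x \<in> (\<Union>d\<in>M. chart_dom d)"
      using atlas by (auto simp: complex_atlas_def smooth_atlas_def)
    then obtain c d where c: "c \<in> S" "x \<in> chart_dom c" and d: "d \<in> M" "f x \<in> chart_dom d" by blast
    have chart: "is_chart c" "is_chart d" using atlas c d by (auto simp: complex_atlas_def smooth_atlas_def)
    define X where "X = rep_dom c d f"
    define F where "F = local_rep c d f"
    let ?Y = "chart_codom d" and ?p = "chart_map c x"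
    have X: "open X" unfolding X_def by (rule open_rep_dom[OF chart cont])
    have Y: "open ?Y" by (rule chart_simps[OF chart(2)])
    have F: "smooth_on X F" using sm c d unfolding smooth_map_def F_def X_def by blast
    have FY: "F ` X \<subseteq> ?Y" unfolding F_def X_def by (rule local_rep_in_codom)
    have p: "?p \<in> X" using chart c d by (simp add: X_def map_in_rep_dom)
    have GK: "G d q (K u) v = K (G d q u v)" "G d q u (K v) = K (G d q u v)" if "q \<in> ?Y" for q u v
    proof -
      have bil: "bilinear (G d q)" using aff d that unfolding affine_connection_def by blast
      show "G d q (K u) v = K (G d q u v)" "G d q u (K v) = K (G d q u v)"
        using K chern_connection_complex_bilinear[OF ch d(1) that]
        by (auto simp: bilinear_lneg[OF bil] bilinear_rneg[OF bil])
    qed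
    have "\<exists>r>0. (\<forall>z\<in>ball ?p r. K.dbar F z = 0) \<or> (\<forall>z\<in>ball ?p r. z \<noteq> ?p \<longrightarrow> K.dbar F z \<noteq> 0)"
    proof (rule K.dbar_zeros_of_quadratic_laplace_equation[OF X Y F FY])
      show "smooth_on ?Y (\<lambda>q. G d q u v)" for u v
        using aff d unfolding affine_connection_def by blast
      show "bilinear (G d q)" if "q \<in> ?Y" for q
        using aff d that unfolding affine_connection_def by blast
      show "dir_deriv 1 (dir_deriv 1 F) z + dir_deriv \<i> (dir_deriv \<i> F) z
          + G d (F z) (dir_deriv 1 F z) (dir_deriv 1 F z) + G d (F z) (dir_deriv \<i> F z) (dir_deriv \<i> F z) = 0"
        if "z \<in> X" for z
        unfolding F_def
        by (rule chern_minimal_equation[OF atlas sm hm lc aff cm c(1) d(1)]) (use that in \<open>simp add: X_def\<close>)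
    qed (use p GK in auto)
    then obtain r where r: "r > 0"
      "(\<forall>z\<in>ball ?p r. K.dbar F z = 0) \<or> (\<forall>z\<in>ball ?p r. z \<noteq> ?p \<longrightarrow> K.dbar F z \<noteq> 0)" by blast
    define U where "U = chart_dom c \<inter> chart_map c -` (X \<inter> ball ?p r)"
    have "open U" unfolding U_def
      by (intro continuous_open_preimage chart_simps[OF chart(1)] open_Int X open_ball)
    moreover have "x \<in> U" using c p r by (simp add: U_def)
    moreover have "complex_linear_point K S M f y \<longleftrightarrow> K.dbar F (chart_map c y) = 0" if y: "y \<in> U" for y
    proof -
      have "y \<in> chart_dom c" "chart_map c y \<in> X" using y by (auto simp: U_def)
      moreover from this have "f y \<in> chart_dom d" using chart by (simp add: X_def map_in_rep_dom)
      ultimately show ?thesis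
        using complex_linear_point_in_charts[OF atlas sm K c(1) _ d(1)] K.dbar_eq_0_iff[OF smooth_onD_differentiable[OF F]]
        by (simp add: complex_linear_wrt_def F_def)
    qed
    moreover have "chart_map c y \<noteq> ?p" if "y \<in> U" "y \<noteq> x" for y
      using that c chart_simps(5)[OF chart(1)] unfolding U_def by (metis IntD1)
    ultimately show ?thesis
      using r(2) by (intro exI[of _ U]) (auto simp: U_def)
  qed
  from discrete_or_everything[OF _ this] show ?thesis
    using S by (auto simp: riemann_surface_def)
qed

theorem proposition2p3:
  fixes S :: "('s::t2_space, complex) chart set"
    and M :: "('m::{t2_space,second_countable_topology}, complex^2) chart set"
    and g :: "('m, complex^2) metric"
    and nabla :: "('m, complex^2) christoffel"
    and f :: "'s \<Rightarrow> 'm"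
    and ds2 :: "('s, complex) metric"
    and D :: "('s, complex) christoffel"
  assumes "riemann_surface S"
    and "hermitian_surface M g"
    and "chern_connection M g nabla"
    and "conformal_isometric_immersion S M g f ds2"
    and "levi_civita_connection S ds2 D"
    and "chern_minimal S M nabla ds2 D f"
    and "generic S M f"
  shows "discrete {x. complex_point S M f x} \<and> discrete {x. anticomplex_point S M f x}"
proof -
  have "smooth_map S M f"
    using assms(4) by (simp add: conformal_isometric_immersion_def immersion_def)
  then have "\<not> (\<forall>x. complex_point S M f x)" "\<not> (\<forall>x. anticomplex_point S M f x)"
    using assms(7) by (auto simp: generic_def holomorphic_map_def antiholomorphic_map_def)
  then show ?thesis
    using complex_linear_points_discrete_or_everything[OF assms(1-6), of J2]
      complex_linear_points_discrete_or_everything[OF assms(1-6), of "\<lambda>v. - J2 v"]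
    by (auto simp: complex_point_iff anticomplex_point_iff)
qed

end
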